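(* Let $G$ be a finite group and let $\rho$ be a faithful integral representation of $G$ on a $\mathbb{Z}G$-module $L$ (a free $\mathbb{Z}$-module of finite rank $n$). Let $U = L\otimes_{\mathbb Z}\mathbb R$ and $V = L\otimes_{\mathbb Z}\mathbb C$ be the real and complex linear spans of $L$. Then, for any $\rho(G)$-invariant real inner product $B$ on $U$ that is integral on $L$, and for any complex number $\tau$ with positive imaginary part, the principally polarized abelian variety $$X = X(B,\tau) = V/(L+\tau L^{*}),\qquad \Im H(u+\tau u', v+\tau v') = B(u,v') - B(v,u')\quad (u,u',v,v'\in U),$$ where $L^{*}$ is the dual of $L$ with respect to $B$, is $\rho$-decomposable. Furthermore, each such $X$ is isomorphic, as a complex torus, to a product of elliptic curves.
   Context: A principally polarized abelian variety (p.p.a.v.) of dimension $n$ is a pair $(X,H)$, where $X=V/\Lambda$ is a complex torus ($V$ a complex vector space of dimension $n$, $\Lambda\subset V$ a lattice of rank $2n$) and $H$ is a positive definite Hermitian form on $V$ whose imaginary part $\Im H$ is integer valued and unimodular on $\Lambda$. Hermitian forms are taken complex linear in the second variable and conjugate linear in the first. A p.p.a.v. $(X,H)$ has a $G$-action if $G$ is a subgroup of the group $\mathrm{Aut}_H(X)$ of automorphisms of the complex torus $X$ preserving $H$; then $G$ acts on $\Lambda$. A decomposition for $H$ is a direct sum $\Lambda = L_1\oplus L_2$ with $L_1$, $L_2$ isotropic for $\Im H$; equivalently, there is a symplectic basis $\lambda_1,\dots,\lambda_n,\mu_1,\dots,\mu_n$ of $\Lambda$ such that $L_1=\langle\lambda_1,\dots,\lambda_n\rangle$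 and $L_2=\langle\mu_1,\dots,\mu_n\rangle$. For a faithful integral representation $\rho$ of $G$ and a p.p.a.v. with $G$-action, it is a $\rho$-decomposition if $L_1$ and $L_2$ are both $G$-invariant and $L_1$ is $\mathbb{Z}G$-equivalent (isomorphic as a $\mathbb ZG$-module) to $\rho$. A p.p.a.v. is $\rho$-decomposable if it has a $G$-action admitting a $\rho$-decomposition. For $X(B,\tau)$ the action of $G$ is the one induced by the $\mathbb C$-linear extension of $\rho$ to $V$. $B$ is integral on $L$ if $B(L,L)\subset\mathbb Z$, and $L^{*}=\{u\in U : B(u,\ell)\in\mathbb Z \text{ for all } \ell\in L\}$. *)

theory Defs
  imports "HOL-Analysis.Analysis" "HOL-Algebra.Group_Action" "HOL-Library.Set_Algebras"
begin

section \<open>Lattices and dual lattices\<close>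

definition add_subgroup :: "'a::ab_group_add set \<Rightarrow> bool" where
  "add_subgroup S \<longleftrightarrow> 0 \<in> S \<and> (\<forall>x\<in>S. \<forall>y\<in>S. x - y \<in> S)"

definition additive_on :: "'a::ab_group_add set \<Rightarrow> ('a \<Rightarrow> 'b::ab_group_add) \<Rightarrow> bool" where
  "additive_on S f \<longleftrightarrow> (\<forall>x\<in>S. \<forall>y\<in>S. f (x + y) = f x + f y)"

definition int_span :: "'a::real_vector set \<Rightarrow> 'a set" where
  "int_span S = {\<Sum>b\<in>S. of_int (c b) *\<^sub>R b | c :: 'a \<Rightarrow> int. True}"

text \<open>A full lattice: the integer span of a real basis of the whole space.  Applied to
  \<^typ>\<open>complex ^ 'n\<close> (real dimension \<open>2n\<close>) this is a lattice of rank \<open>2n\<close>.  Applied to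
  \<^typ>\<open>real ^ 'n\<close> it describes a free abelian group \<open>L\<close> of rank \<open>n\<close> together with its real span
  \<open>U = L \<otimes> \<real>\<close>, a \<open>\<int>\<close>-basis of \<open>L\<close> being an \<open>\<real>\<close>-basis of \<open>U\<close>.\<close>

definition full_lattice :: "'a::euclidean_space set \<Rightarrow> bool" where
  "full_lattice \<Lambda> \<longleftrightarrow>
     (\<exists>S. finite S \<and> independent S \<and> span S = UNIV \<and> \<Lambda> = int_span S)"

definition inner_product :: "('a::real_vector \<Rightarrow> 'a \<Rightarrow> real) \<Rightarrow> bool" where
  "inner_product B \<longleftrightarrow>
     bilinear B \<and> (\<forall>u v. B u v = B v u) \<and> (\<forall>u. u \<noteq> 0 \<longrightarrow> B u u > 0)"

definition integral_on :: "('a \<Rightarrow> 'a \<Rightarrow> real) \<Rightarrow> 'a set \<Rightarrow> bool" where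
  "integral_on B L \<longleftrightarrow> (\<forall>x\<in>L. \<forall>y\<in>L. B x y \<in> \<int>)"

definition dual_lattice :: "('a \<Rightarrow> 'a \<Rightarrow> real) \<Rightarrow> 'a set \<Rightarrow> 'a set" where
  "dual_lattice B L = {u. \<forall>l\<in>L. B u l \<in> \<int>}"

section \<open>Complex tori and their homomorphisms\<close>

abbreviation clinear :: "(complex ^ 'n \<Rightarrow> complex ^ 'm) \<Rightarrow> bool" where
  "clinear F \<equiv> Vector_Spaces.linear (*s) (*s) F"

text \<open>The points of \<open>V/\<Lambda>\<close> are the cosets \<open>v +o \<Lambda>\<close>; they are added as sets.\<close>

definition torus :: "'a::ab_group_add set \<Rightarrow> 'a set set" where
  "torus \<Lambda> = range (\<lambda>v. v +o \<Lambda>)"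

text \<open>The charts of \<open>V/\<Lambda>\<close> are the local inverses of the projection \<open>v \<mapsto> v +o \<Lambda>\<close>, so a map of
  tori is holomorphic iff near every point of \<open>V\<close> it is covered by a holomorphic map.\<close>

definition torus_holomorphic ::
  "(complex ^ 'n) set \<Rightarrow> (complex ^ 'm) set \<Rightarrow> ((complex ^ 'n) set \<Rightarrow> (complex ^ 'm) set) \<Rightarrow> bool"
  where
  "torus_holomorphic \<Lambda> \<Lambda>' f \<longleftrightarrow>
     (\<forall>v. \<exists>W F. open W \<and> v \<in> W \<and>
        (\<forall>w\<in>W. (\<exists>D. clinear D \<and> (F has_derivative D) (at w)) \<and> f (w +o \<Lambda>) = F w +o \<Lambda>'))"

definition torus_hom ::
  "(complex ^ 'n) set \<Rightarrow> (complex ^ 'm) set \<Rightarrow> ((complex ^ 'n) set \<Rightarrow> (complex ^ 'm) set) \<Rightarrow> bool"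
  where
  "torus_hom \<Lambda> \<Lambda>' f \<longleftrightarrow>
     f \<in> torus \<Lambda> \<rightarrow> torus \<Lambda>' \<and>
     (\<forall>P\<in>torus \<Lambda>. \<forall>Q\<in>torus \<Lambda>. f (P + Q) = f P + f Q) \<and>
     torus_holomorphic \<Lambda> \<Lambda>' f"

definition torus_iso ::
  "(complex ^ 'n) set \<Rightarrow> (complex ^ 'm) set \<Rightarrow> ((complex ^ 'n) set \<Rightarrow> (complex ^ 'm) set) \<Rightarrow> bool"
  where
  "torus_iso \<Lambda> \<Lambda>' f \<longleftrightarrow>
     bij_betw f (torus \<Lambda>) (torus \<Lambda>') \<and>
     torus_hom \<Lambda> \<Lambda>' f \<and> torus_hom \<Lambda>' \<Lambda> (inv_into (torus \<Lambda>) f)"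

text \<open>Every homomorphism \<open>V/\<Lambda> \<rightarrow> V/\<Lambda>\<close> of complex tori has a unique \<open>\<complex>\<close>-linear lift \<open>V \<rightarrow> V\<close>.
  Through this lift it acts on \<open>\<Lambda>\<close> and on Hermitian forms on \<open>V\<close>.\<close>

definition analytic_rep ::
  "(complex ^ 'n) set \<Rightarrow> ((complex ^ 'n) set \<Rightarrow> (complex ^ 'n) set) \<Rightarrow> complex ^ 'n \<Rightarrow> complex ^ 'n"
  where
  "analytic_rep \<Lambda> f = (THE F. clinear F \<and> (\<forall>v. f (v +o \<Lambda>) = F v +o \<Lambda>))"

text \<open>With \<open>E i \<subseteq> \<complex>\<close> a lattice, \<open>\<complex>/E i\<close> is an elliptic curve; the product over all \<open>i\<close> is the
  complex torus \<open>\<complex>\<^sup>n/(\<Prod>i. E i)\<close>.\<close>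

definition product_lattice :: "('n \<Rightarrow> complex set) \<Rightarrow> (complex ^ 'n) set" where
  "product_lattice E = {z. \<forall>i. z $ i \<in> E i}"

definition iso_product_of_elliptic_curves :: "(complex ^ 'n) set \<Rightarrow> bool" where
  "iso_product_of_elliptic_curves \<Lambda> \<longleftrightarrow>
     (\<exists>E :: 'n \<Rightarrow> complex set. (\<forall>i. full_lattice (E i)) \<and>
        (\<exists>f. torus_iso \<Lambda> (product_lattice E) f))"

section \<open>Principally polarized abelian varieties\<close>

definition hermitian_form :: "(complex ^ 'n \<Rightarrow> complex ^ 'n \<Rightarrow> complex) \<Rightarrow> bool" where
  "hermitian_form H \<longleftrightarrow>
     (\<forall>x y z. H x (y + z) = H x y + H x z) \<and>
     (\<forall>x y c. H x (c *s y) = c * H x y) \<and>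
     (\<forall>x y. H y x = cnj (H x y))"

definition pos_def_hermitian :: "(complex ^ 'n \<Rightarrow> complex ^ 'n \<Rightarrow> complex) \<Rightarrow> bool" where
  "pos_def_hermitian H \<longleftrightarrow> hermitian_form H \<and> (\<forall>x. x \<noteq> 0 \<longrightarrow> Re (H x x) > 0)"

text \<open>Unimodular: \<open>x \<mapsto> E x\<close> is a bijection from \<open>\<Lambda>\<close> onto the group of homomorphisms \<open>\<Lambda> \<rightarrow> \<int>\<close>.\<close>

definition unimodular_on :: "('a::ab_group_add \<Rightarrow> 'a \<Rightarrow> real) \<Rightarrow> 'a set \<Rightarrow> bool" where
  "unimodular_on E \<Lambda> \<longleftrightarrow>
     (\<forall>f. additive_on \<Lambda> f \<and> (\<forall>x\<in>\<Lambda>. f x \<in> \<int>) \<longrightarrow> (\<exists>!x. x \<in> \<Lambda> \<and> (\<forall>y\<in>\<Lambda>. E x y = f y)))"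

definition ppav :: "(complex ^ 'n) set \<Rightarrow> (complex ^ 'n \<Rightarrow> complex ^ 'n \<Rightarrow> complex) \<Rightarrow> bool" where
  "ppav \<Lambda> H \<longleftrightarrow>
     full_lattice \<Lambda> \<and> pos_def_hermitian H \<and>
     integral_on (\<lambda>x y. Im (H x y)) \<Lambda> \<and> unimodular_on (\<lambda>x y. Im (H x y)) \<Lambda>"

text \<open>Automorphisms are taken as extensional functions on \<open>torus \<Lambda>\<close>, so that they form a subgroup
  of \<^term>\<open>BijGroup (torus \<Lambda>)\<close>.\<close>

definition aut_preserving ::
  "(complex ^ 'n) set \<Rightarrow> (complex ^ 'n \<Rightarrow> complex ^ 'n \<Rightarrow> complex) \<Rightarrow>
     ((complex ^ 'n) set \<Rightarrow> (complex ^ 'n) set) set" where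
  "aut_preserving \<Lambda> H =
     {f \<in> Bij (torus \<Lambda>). torus_iso \<Lambda> \<Lambda> f \<and>
        (\<forall>v w. H (analytic_rep \<Lambda> f v) (analytic_rep \<Lambda> f w) = H v w)}"

text \<open>The group is identified with a subgroup of the automorphism group by an injective
  homomorphism \<open>\<phi>\<close>.\<close>

definition ppav_action ::
  "('g, 'k) monoid_scheme \<Rightarrow> (complex ^ 'n) set \<Rightarrow> (complex ^ 'n \<Rightarrow> complex ^ 'n \<Rightarrow> complex) \<Rightarrow>
     ('g \<Rightarrow> (complex ^ 'n) set \<Rightarrow> (complex ^ 'n) set) \<Rightarrow> bool" where
  "ppav_action G \<Lambda> H \<phi> \<longleftrightarrow>
     faithful_action G (torus \<Lambda>) \<phi> \<and> (\<forall>g\<in>carrier G. \<phi> g \<in> aut_preserving \<Lambda> H)"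

section \<open>Integral representations and decompositions\<close>

definition faithful_integral_rep ::
  "('g, 'k) monoid_scheme \<Rightarrow> (real ^ 'n) set \<Rightarrow> ('g \<Rightarrow> real ^ 'n \<Rightarrow> real ^ 'n) \<Rightarrow> bool" where
  "faithful_integral_rep G L \<rho> \<longleftrightarrow>
     full_lattice L \<and> faithful_action G L \<rho> \<and> (\<forall>g\<in>carrier G. additive_on L (\<rho> g))"

text \<open>An additive map on a full lattice \<open>L\<close> of \<open>U\<close> has a unique \<open>\<real>\<close>-linear extension to \<open>U\<close> and a
  unique \<open>\<complex>\<close>-linear extension to \<open>V = L \<otimes> \<complex>\<close>, into which \<open>U\<close> is embedded coordinatewise.\<close>

definition cvec :: "real ^ 'n \<Rightarrow> complex ^ 'n" where
  "cvec u = (\<chi> i. complex_of_real (u $ i))"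

definition real_extension ::
  "(real ^ 'n) set \<Rightarrow> (real ^ 'n \<Rightarrow> real ^ 'n) \<Rightarrow> real ^ 'n \<Rightarrow> real ^ 'n" where
  "real_extension L f = (THE F. linear F \<and> (\<forall>l\<in>L. F l = f l))"

definition complex_extension ::
  "(real ^ 'n) set \<Rightarrow> (real ^ 'n \<Rightarrow> real ^ 'n) \<Rightarrow> complex ^ 'n \<Rightarrow> complex ^ 'n" where
  "complex_extension L f = (THE F. clinear F \<and> (\<forall>l\<in>L. F (cvec l) = cvec (f l)))"

definition invariant_form ::
  "('g, 'k) monoid_scheme \<Rightarrow> (real ^ 'n) set \<Rightarrow> ('g \<Rightarrow> real ^ 'n \<Rightarrow> real ^ 'n) \<Rightarrow>
     (real ^ 'n \<Rightarrow> real ^ 'n \<Rightarrow> real) \<Rightarrow> bool" where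
  "invariant_form G L \<rho> B \<longleftrightarrow>
     (\<forall>g\<in>carrier G. \<forall>u v. B (real_extension L (\<rho> g) u) (real_extension L (\<rho> g) v) = B u v)"

definition decomposition ::
  "(complex ^ 'n) set \<Rightarrow> (complex ^ 'n \<Rightarrow> complex ^ 'n \<Rightarrow> complex) \<Rightarrow>
     (complex ^ 'n) set \<Rightarrow> (complex ^ 'n) set \<Rightarrow> bool" where
  "decomposition \<Lambda> H L\<^sub>1 L\<^sub>2 \<longleftrightarrow>
     add_subgroup L\<^sub>1 \<and> add_subgroup L\<^sub>2 \<and> L\<^sub>1 + L\<^sub>2 = \<Lambda> \<and> L\<^sub>1 \<inter> L\<^sub>2 = {0} \<and>
     (\<forall>x\<in>L\<^sub>1. \<forall>y\<in>L\<^sub>1. Im (H x y) = 0) \<and> (\<forall>x\<in>L\<^sub>2. \<forall>y\<in>L\<^sub>2. Im (H x y) = 0)"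

definition rho_decomposition ::
  "('g, 'k) monoid_scheme \<Rightarrow> (real ^ 'n) set \<Rightarrow> ('g \<Rightarrow> real ^ 'n \<Rightarrow> real ^ 'n) \<Rightarrow>
     (complex ^ 'n) set \<Rightarrow> (complex ^ 'n \<Rightarrow> complex ^ 'n \<Rightarrow> complex) \<Rightarrow>
     ('g \<Rightarrow> (complex ^ 'n) set \<Rightarrow> (complex ^ 'n) set) \<Rightarrow>
     (complex ^ 'n) set \<Rightarrow> (complex ^ 'n) set \<Rightarrow> bool" where
  "rho_decomposition G L \<rho> \<Lambda> H \<phi> L\<^sub>1 L\<^sub>2 \<longleftrightarrow>
     decomposition \<Lambda> H L\<^sub>1 L\<^sub>2 \<and>
     (\<forall>g\<in>carrier G. analytic_rep \<Lambda> (\<phi> g) ` L\<^sub>1 \<subseteq> L\<^sub>1 \<and> analytic_rep \<Lambda> (\<phi> g) ` L\<^sub>2 \<subseteq> L\<^sub>2) \<and>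
     (\<exists>\<psi>. bij_betw \<psi> L L\<^sub>1 \<and> additive_on L \<psi> \<and>
        (\<forall>g\<in>carrier G. \<forall>l\<in>L. \<psi> (\<rho> g l) = analytic_rep \<Lambda> (\<phi> g) (\<psi> l)))"

definition rho_decomposable ::
  "('g, 'k) monoid_scheme \<Rightarrow> (real ^ 'n) set \<Rightarrow> ('g \<Rightarrow> real ^ 'n \<Rightarrow> real ^ 'n) \<Rightarrow>
     (complex ^ 'n) set \<Rightarrow> (complex ^ 'n \<Rightarrow> complex ^ 'n \<Rightarrow> complex) \<Rightarrow> bool" where
  "rho_decomposable G L \<rho> \<Lambda> H \<longleftrightarrow>
     ppav \<Lambda> H \<and>
     (\<exists>\<phi>. ppav_action G \<Lambda> H \<phi> \<and> (\<exists>L\<^sub>1 L\<^sub>2. rho_decomposition G L \<rho> \<Lambda> H \<phi> L\<^sub>1 L\<^sub>2))"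

section \<open>The variety \<open>X(B,\<tau>)\<close>\<close>

definition X_lattice ::
  "(real ^ 'n) set \<Rightarrow> (real ^ 'n \<Rightarrow> real ^ 'n \<Rightarrow> real) \<Rightarrow> complex \<Rightarrow> (complex ^ 'n) set" where
  "X_lattice L B \<tau> = {cvec l + \<tau> *s cvec m | l m. l \<in> L \<and> m \<in> dual_lattice B L}"

definition X_form ::
  "(real ^ 'n \<Rightarrow> real ^ 'n \<Rightarrow> real) \<Rightarrow> complex \<Rightarrow> (complex ^ 'n \<Rightarrow> complex ^ 'n \<Rightarrow> complex) \<Rightarrow> bool"
  where
  "X_form B \<tau> H \<longleftrightarrow>
     hermitian_form H \<and>
     (\<forall>u u' v v'. Im (H (cvec u + \<tau> *s cvec u') (cvec v + \<tau> *s cvec v')) = B u v' - B v u')"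

definition X_action ::
  "(real ^ 'n) set \<Rightarrow> ('g \<Rightarrow> real ^ 'n \<Rightarrow> real ^ 'n) \<Rightarrow> (complex ^ 'n) set \<Rightarrow>
     'g \<Rightarrow> (complex ^ 'n) set \<Rightarrow> (complex ^ 'n) set" where
  "X_action L \<rho> \<Lambda> g = (\<lambda>P\<in>torus \<Lambda>. complex_extension L (\<rho> g) ` P)"

end

theory Submission
  imports Defs
begin

text \<open>
  Write \<open>M\<close> for the dual lattice of \<open>L\<close>.  As \<open>Im \<tau> \<noteq> 0\<close>, every vector of \<open>V\<close> is uniquely
  \<open>u + \<tau> u'\<close> with \<open>u, u'\<close> real, so \<open>L + \<tau> M\<close> is a lattice, and the prescribed imaginary part
  determines the Hermitian form, because \<open>Re H(x, y) = Im H(x, i y)\<close>.  The form that has this imaginary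
  part is \<open>H(x, y) = B(conj x, y) / Im \<tau>\<close> with \<open>B\<close> extended complex bilinearly; it is
  positive definite because \<open>H(a + i b, a + i b) = (B(a, a) + B(b, b)) / Im \<tau>\<close> for real \<open>a, b\<close>.

  The imaginary part pairs \<open>L\<close> with \<open>\<tau> M\<close> through \<open>B\<close> and vanishes on each of the two summands.  Hence
  unimodularity says that \<open>B\<close> identifies \<open>M\<close> with the homomorphisms from \<open>L\<close> to the integers, and \<open>L\<close>
  with those on \<open>M\<close>.  Both follow from the representation of functionals by \<open>B\<close>
  (\<open>inner_product_represents_functional\<close>) together with the reflexivity of lattices
  (\<open>dual_dual_lattice\<close>).

  A group element acts on \<open>U\<close> by a \<open>B\<close>-isometry that maps \<open>L\<close> onto itself, and therefore also \<open>M\<close>.  Its complex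
  linear extension acts on both real coordinates \<open>u, u'\<close> separately.  It preserves
  \<open>L\<close>, \<open>\<tau> M\<close> and the imaginary part of \<open>H\<close>, and hence, by uniqueness, \<open>H\<close> itself.  So the summands \<open>L\<close>
  and \<open>\<tau> M\<close> form the required decomposition, and the inclusion of \<open>L\<close> is the equivalence with \<open>\<rho>\<close>.

  Integrality of \<open>B\<close> means that \<open>L\<close> is contained in \<open>M\<close>.  By the elementary divisor theorem
  (\<open>stacked_basis\<close>) some basis \<open>b\<^sub>1, \<dots>, b\<^sub>n\<close> of \<open>M\<close> has multiples \<open>d\<^sub>1 b\<^sub>1, \<dots>, d\<^sub>n b\<^sub>n\<close> that form a
  basis of \<open>L\<close>.  In the complex coordinates given by the \<open>b\<^sub>i\<close>, the lattice \<open>L + \<tau> M\<close> is the product of the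
  lattices \<open>\<int> d\<^sub>i + \<int> \<tau>\<close> in the complex plane.
\<close>

section \<open>Lattices\<close>

lemma int_spanI: "x = (\<Sum>b\<in>S. of_int (c b) *\<^sub>R b) \<Longrightarrow> x \<in> int_span S"
  by (auto simp: int_span_def)

lemma int_spanE:
  assumes "x \<in> int_span S"
  obtains c :: "'a::real_vector \<Rightarrow> int" where "x = (\<Sum>b\<in>S. of_int (c b) *\<^sub>R b)"
  using assms by (auto simp: int_span_def)

lemma add_subgroupD:
  assumes "add_subgroup S"
  shows "0 \<in> S" "\<And>x y. x \<in> S \<Longrightarrow> y \<in> S \<Longrightarrow> x - y \<in> S"
    "\<And>x. x \<in> S \<Longrightarrow> - x \<in> S" "\<And>x y. x \<in> S \<Longrightarrow> y \<in> S \<Longrightarrow> x + y \<in> S"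
proof -
  show 0: "0 \<in> S" and diff: "\<And>x y. x \<in> S \<Longrightarrow> y \<in> S \<Longrightarrow> x - y \<in> S"
    using assms by (auto simp: add_subgroup_def)
  show neg: "- x \<in> S" if "x \<in> S" for x using diff[OF 0 that] by simp
  show "x + y \<in> S" if "x \<in> S" "y \<in> S" for x y using diff[OF that(1) neg[OF that(2)]] by simp
qed

lemma add_subgroup_scale_int:
  fixes x :: "'a::real_vector"
  assumes "add_subgroup S" "x \<in> S"
  shows "of_int k *\<^sub>R x \<in> S"
proof -
  have nat: "of_nat n *\<^sub>R x \<in> S" for n
    by (induction n) (use add_subgroupD[OF assms(1)] assms(2) in \<open>auto simp: scaleR_add_left\<close>)
  show ?thesis
  proof (cases "k \<ge> 0")
    case True
    with nat[of "nat k"] show ?thesis by simp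
  next
    case False
    with add_subgroupD(3)[OF assms(1) nat[of "nat (- k)"]] show ?thesis by simp
  qed
qed

lemma add_subgroup_scale_Ints:
  fixes x :: "'a::real_vector"
  assumes "add_subgroup S" "x \<in> S" "r \<in> \<int>"
  shows "r *\<^sub>R x \<in> S"
  using assms(3) add_subgroup_scale_int[OF assms(1,2)] by (auto elim: Ints_cases)

lemma add_subgroup_sum:
  assumes "add_subgroup S" "\<And>i. i \<in> I \<Longrightarrow> f i \<in> S"
  shows "sum f I \<in> S"
  using assms(2) by (induction I rule: infinite_finite_induct) (auto simp: add_subgroupD[OF assms(1)])

lemma add_subgroup_int_span: "add_subgroup (int_span S)"
  unfolding add_subgroup_def
proof (intro conjI ballI)
  show "0 \<in> int_span S"
    by (rule int_spanI[where c = "\<lambda>_. 0"]) simp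
next
  fix x y assume "x \<in> int_span S" "y \<in> int_span S"
  then obtain a b where "x = (\<Sum>s\<in>S. of_int (a s) *\<^sub>R s)" "y = (\<Sum>s\<in>S. of_int (b s) *\<^sub>R s)"
    by (elim int_spanE) blast
  then have "x - y = (\<Sum>s\<in>S. of_int (a s - b s) *\<^sub>R s)"
    by (simp add: scaleR_diff_left sum_subtractf)
  then show "x - y \<in> int_span S" by (rule int_spanI)
qed

lemma int_span_base:
  assumes "finite S" "s \<in> S"
  shows "s \<in> int_span S"
proof (rule int_spanI)
  have "(\<Sum>b\<in>S. of_int (if b = s then 1 else 0) *\<^sub>R b) = (\<Sum>b\<in>S. if b = s then b else 0)"
    by (rule sum.cong) auto
  then show "s = (\<Sum>b\<in>S. of_int (if b = s then 1 else 0) *\<^sub>R b)"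
    using assms by simp
qed

lemma int_span_minimal:
  assumes "add_subgroup N" "S \<subseteq> N"
  shows "int_span S \<subseteq> N"
  using assms by (auto elim!: int_spanE intro!: add_subgroup_sum add_subgroup_scale_int)

lemma int_span_subset_span: "int_span S \<subseteq> span S"
  by (auto elim!: int_spanE intro!: span_sum span_scale intro: span_base)

lemma span_int_span:
  assumes "finite S"
  shows "span (int_span S) = span S"
proof
  show "span (int_span S) \<subseteq> span S"
    by (rule span_minimal[OF int_span_subset_span subspace_span])
  show "span S \<subseteq> span (int_span S)"
    by (rule span_mono) (use int_span_base[OF assms] in auto)
qed

lemma int_span_insert:
  assumes "finite S" "t \<notin> S"
  shows "int_span (insert t S) = {of_int k *\<^sub>R t + y | k y. y \<in> int_span S}"
proof (intro Set.set_eqI iffI)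
  fix x assume "x \<in> int_span (insert t S)"
  then obtain c where "x = (\<Sum>b\<in>insert t S. of_int (c b) *\<^sub>R b)"
    by (rule int_spanE)
  then have "x = of_int (c t) *\<^sub>R t + (\<Sum>b\<in>S. of_int (c b) *\<^sub>R b)"
    using assms by simp
  then show "x \<in> {of_int k *\<^sub>R t + y | k y. y \<in> int_span S}"
    using int_spanI by blast
next
  fix x assume "x \<in> {of_int k *\<^sub>R t + y | k y. y \<in> int_span S}"
  then obtain k c where "x = of_int k *\<^sub>R t + (\<Sum>b\<in>S. of_int (c b) *\<^sub>R b)"
    by (auto elim: int_spanE)
  moreover have "(\<Sum>b\<in>S. of_int (if b = t then k else c b) *\<^sub>R b) = (\<Sum>b\<in>S. of_int (c b) *\<^sub>R b)"
    by (rule sum.cong) (use assms(2) in auto)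
  ultimately have "x = (\<Sum>b\<in>insert t S. of_int (if b = t then k else c b) *\<^sub>R b)"
    using assms by simp
  then show "x \<in> int_span (insert t S)" by (rule int_spanI)
qed

lemma int_span_linear_image:
  assumes "linear f" "inj f"
  shows "int_span (f ` S) = f ` int_span S"
proof (intro Set.set_eqI iffI)
  fix x assume "x \<in> int_span (f ` S)"
  then obtain c where "x = (\<Sum>b\<in>f ` S. of_int (c b) *\<^sub>R b)" by (rule int_spanE)
  also have "\<dots> = (\<Sum>b\<in>S. of_int (c (f b)) *\<^sub>R f b)"
    by (subst sum.reindex) (auto intro: inj_on_subset[OF assms(2)])
  also have "\<dots> = f (\<Sum>b\<in>S. of_int (c (f b)) *\<^sub>R b)"
    by (simp add: linear_sum[OF assms(1)] linear_cmul[OF assms(1)])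
  finally show "x \<in> f ` int_span S" using int_spanI[OF refl, of "c \<circ> f"] by auto
next
  fix x assume "x \<in> f ` int_span S"
  then obtain c where "x = f (\<Sum>b\<in>S. of_int (c b) *\<^sub>R b)" by (auto elim: int_spanE)
  also have "\<dots> = (\<Sum>b\<in>S. of_int (c (inv_into UNIV f (f b))) *\<^sub>R f b)"
    by (simp add: linear_sum[OF assms(1)] linear_cmul[OF assms(1)] inv_f_f[OF assms(2)])
  also have "\<dots> = (\<Sum>b\<in>f ` S. of_int (c (inv_into UNIV f b)) *\<^sub>R b)"
    by (subst sum.reindex) (auto intro: inj_on_subset[OF assms(2)])
  finally show "x \<in> int_span (f ` S)" by (rule int_spanI)
qed

lemma additive_on_linear_combination:
  fixes f :: "'a::real_vector \<Rightarrow> 'b::real_vector"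
  assumes S: "add_subgroup S" and f: "additive_on S f"
    and b: "\<And>i. i \<in> I \<Longrightarrow> b i \<in> S"
  shows "f (\<Sum>i\<in>I. of_int (c i) *\<^sub>R b i) = (\<Sum>i\<in>I. of_int (c i) *\<^sub>R f (b i))"
proof -
  note D = add_subgroupD[OF S]
  have add: "f (x + y) = f x + f y" if "x \<in> S" "y \<in> S" for x y
    using f that by (simp add: additive_on_def)
  have zero: "f 0 = 0" using add[of 0 0] D(1) by simp
  have neg: "f (- x) = - f x" if "x \<in> S" for x
    using add[of "- x" x] D(3)[OF that] that zero by (simp add: eq_neg_iff_add_eq_0)
  have nat: "f (of_nat n *\<^sub>R x) = of_nat n *\<^sub>R f x" if "x \<in> S" for n x
  proof (induction n)
    case (Suc n)
    have "of_nat n *\<^sub>R x \<in> S" using add_subgroup_scale_int[OF S that, of "int n"] by simp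
    with Suc add[OF that this] show ?case by (simp add: scaleR_add_left)
  qed (simp add: zero)
  have int: "f (of_int k *\<^sub>R x) = of_int k *\<^sub>R f x" if "x \<in> S" for k x
  proof (cases "k \<ge> 0")
    case True
    with nat[OF that, of "nat k"] show ?thesis by simp
  next
    case False
    with nat[OF D(3)[OF that], of "nat (- k)"] neg[OF that] show ?thesis by simp
  qed
  show ?thesis
    using b
  proof (induction I rule: infinite_finite_induct)
    case (insert i I)
    have "(\<Sum>j\<in>I. of_int (c j) *\<^sub>R b j) \<in> S" "of_int (c i) *\<^sub>R b i \<in> S"
      using insert.prems by (auto intro!: add_subgroup_sum[OF S] add_subgroup_scale_int[OF S])
    with insert show ?case by (simp add: add int)
  qed (simp_all add: zero)
qed

lemma full_lattice_add_subgroup: "full_lattice L \<Longrightarrow> add_subgroup L"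
  by (auto simp: full_lattice_def add_subgroup_int_span)

lemma full_lattice_span:
  "full_lattice L \<Longrightarrow> span L = UNIV"
  by (auto simp: full_lattice_def span_int_span)

lemma full_lattice_int_span:
  fixes S :: "'a::euclidean_space set"
  assumes "finite S" "span S = UNIV" "card S \<le> DIM('a)"
  shows "full_lattice (int_span S)"
proof -
  have "independent S"
    by (rule card_le_dim_spanning[of S UNIV]) (use assms in \<open>auto simp: dim_UNIV\<close>)
  then show ?thesis using assms by (auto simp: full_lattice_def)
qed

lemma full_lattice_linear_image:
  fixes f :: "'a::euclidean_space \<Rightarrow> 'b::euclidean_space"
  assumes "linear f" "bij f" "full_lattice L"
  shows "full_lattice (f ` L)"
proof -
  obtain S where S: "finite S" "independent S" "span S = UNIV" "L = int_span S"
    using assms(3) by (auto simp: full_lattice_def)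
  have "f ` L = int_span (f ` S)"
    using int_span_linear_image[OF assms(1) bij_is_inj[OF assms(2)]] S(4) by simp
  moreover have "independent (f ` S)"
    by (rule linear_independent_injective_image[OF assms(1) S(2)])
       (use bij_is_inj[OF assms(2)] inj_on_subset in blast)
  moreover have "span (f ` S) = UNIV"
    using assms(1,2) S(3) by (simp add: linear_span_image bij_is_surj)
  ultimately show ?thesis using S(1) by (auto simp: full_lattice_def)
qed

lemma full_lattice_Times:
  fixes L :: "'a::euclidean_space set" and M :: "'b::euclidean_space set"
  assumes "full_lattice L" "full_lattice M"
  shows "full_lattice (L \<times> M)"
proof -
  obtain S where S: "finite S" "independent S" "span S = UNIV" "L = int_span S"
    using assms(1) by (auto simp: full_lattice_def)
  obtain T where T: "finite T" "independent T" "span T = UNIV" "M = int_span T"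
    using assms(2) by (auto simp: full_lattice_def)
  let ?i = "\<lambda>x. (x, 0::'b)" and ?j = "\<lambda>y. (0::'a, y)"
  let ?W = "?i ` S \<union> ?j ` T"
  have i: "linear ?i" "inj ?i" and j: "linear ?j" "inj ?j"
    by (auto simp: linear_iff inj_def)
  have fin: "finite ?W" using S(1) T(1) by simp
  have sub: "int_span (?i ` S) \<subseteq> int_span ?W" "int_span (?j ` T) \<subseteq> int_span ?W"
    by (rule int_span_minimal[OF add_subgroup_int_span]; use int_span_base[OF fin] in blast)+
  have "int_span ?W = L \<times> M"
  proof
    have "add_subgroup (L \<times> M)"
      using full_lattice_add_subgroup[OF assms(1)] full_lattice_add_subgroup[OF assms(2)]
      by (auto simp: add_subgroup_def zero_prod_def)
    moreover have "?W \<subseteq> L \<times> M"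
      using int_span_base[OF S(1)] int_span_base[OF T(1)] S(4) T(4)
        add_subgroupD(1)[OF full_lattice_add_subgroup[OF assms(1)]]
        add_subgroupD(1)[OF full_lattice_add_subgroup[OF assms(2)]] by blast
    ultimately show "int_span ?W \<subseteq> L \<times> M" by (rule int_span_minimal)
    show "L \<times> M \<subseteq> int_span ?W"
    proof
      fix p assume "p \<in> L \<times> M"
      then have "?i (fst p) \<in> int_span ?W" "?j (snd p) \<in> int_span ?W"
        using sub unfolding int_span_linear_image[OF i] int_span_linear_image[OF j] S(4) T(4) by auto
      then have "?i (fst p) + ?j (snd p) \<in> int_span ?W"
        by (rule add_subgroupD(4)[OF add_subgroup_int_span])
      then show "p \<in> int_span ?W" by simp
    qed
  qed
  moreover have "span ?W = UNIV"
  proof -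
    have "p \<in> span ?W" for p
    proof -
      have "?i (fst p) \<in> span (?i ` S)" "?j (snd p) \<in> span (?j ` T)"
        using S(3) T(3) by (auto simp: linear_span_image[OF i(1)] linear_span_image[OF j(1)])
      then have "?i (fst p) + ?j (snd p) \<in> span ?W"
        by (intro span_add) (meson span_mono subsetD sup_ge1 sup_ge2)+
      then show ?thesis by simp
    qed
    then show ?thesis by auto
  qed
  moreover have "card ?W \<le> DIM('a \<times> 'b)"
  proof -
    have "card ?W \<le> card S + card T"
      by (rule order_trans[OF card_Un_le]) (intro add_mono card_image_le S(1) T(1))
    also have "\<dots> = DIM('a \<times> 'b)"
      using basis_card_eq_dim[of S UNIV] basis_card_eq_dim[of T UNIV] S T by (simp add: dim_UNIV)
    finally show ?thesis .
  qed
  ultimately show ?thesis using full_lattice_int_span[OF fin] by metis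
qed

lemma int_span_iff_representation:
  fixes S :: "'a::real_vector set"
  assumes S: "finite S" "independent S" "y \<in> span S"
  shows "y \<in> int_span S \<longleftrightarrow> (\<forall>s\<in>S. representation S y s \<in> \<int>)"
proof (intro iffI ballI)
  fix s assume y: "y \<in> int_span S" and s: "s \<in> S"
  obtain c where c: "y = (\<Sum>b\<in>S. of_int (c b) *\<^sub>R b)" using y by (rule int_spanE)
  have "representation S y s = (\<Sum>b\<in>S. of_int (c b) * representation S b s)"
    unfolding c using S by (simp add: representation_sum representation_scale span_base span_scale)
  also have "\<dots> = (\<Sum>b\<in>S. if b = s then of_int (c b) else 0)"
    by (rule sum.cong) (use S in \<open>auto simp: representation_basis\<close>)
  also have "\<dots> = of_int (c s)"
    using S s by simp
  finally show "representation S y s \<in> \<int>" by simp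
next
  assume "\<forall>s\<in>S. representation S y s \<in> \<int>"
  then have "(\<Sum>s\<in>S. representation S y s *\<^sub>R s) \<in> int_span S"
    by (intro add_subgroup_sum[OF add_subgroup_int_span])
       (auto intro: add_subgroup_scale_Ints[OF add_subgroup_int_span int_span_base[OF S(1)]])
  then show "y \<in> int_span S" using S by (simp add: sum_representation_eq)
qed

text \<open>A lattice is discrete.  This is what makes the linear lift of a homomorphism of tori unique: two lifts
  differ by a linear map with values in the lattice.\<close>

lemma full_lattice_no_line:
  assumes "full_lattice L" "\<And>r. r *\<^sub>R x \<in> L"
  shows "x = 0"
proof -
  obtain S where S: "finite S" "independent S" "span S = UNIV" "L = int_span S"
    using assms(1) by (auto simp: full_lattice_def)
  have int: "representation S y s \<in> \<int>" if "y \<in> L" "s \<in> S" for y s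
    using that int_span_iff_representation[OF S(1,2), of y] S(3,4) by auto
  have "representation S x s = 0" if s: "s \<in> S" for s
  proof (rule ccontr)
    assume *: "representation S x s \<noteq> 0"
    have "representation S ((1 / (2 * representation S x s)) *\<^sub>R x) s = 1 / 2"
      using S * by (simp add: representation_scale)
    then have "(1 / 2 :: real) \<in> \<int>" using int[OF assms(2) s] by metis
    then obtain k :: int where "(1 / 2 :: real) = of_int k" by (auto elim: Ints_cases)
    then have "(1 :: real) = of_int (2 * k)" by simp
    then have "1 = 2 * k" by linarith
    then show False by presburger
  qed
  moreover have "x = (\<Sum>s\<in>S. representation S x s *\<^sub>R s)"
    using S by (simp add: sum_representation_eq)
  ultimately show "x = 0" by simp
qed

section \<open>Stacked bases\<close>

lemma int_span_basis_exchange: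
  assumes "finite S" "t \<notin> S" "independent (insert t S)" "y \<in> int_span S"
  shows "t + y \<notin> S" "independent (insert (t + y) S)"
    "int_span (insert (t + y) S) = int_span (insert t S)"
proof -
  have y: "y \<in> span S" using assms(4) int_span_subset_span by blast
  have ind: "independent S" "t \<notin> span S" using assms(2,3) by (auto simp: independent_insert)
  have "t + y \<notin> span S"
    using ind(2) span_diff[of "t + y" S y] y by auto
  then show notin: "t + y \<notin> S" and "independent (insert (t + y) S)"
    using ind(1) by (auto simp: independent_insert span_base)
  note D = add_subgroupD[OF add_subgroup_int_span[of S]]
  have scaled: "of_int k *\<^sub>R y \<in> int_span S" for k
    by (rule add_subgroup_scale_int[OF add_subgroup_int_span assms(4)])
  show "int_span (insert (t + y) S) = int_span (insert t S)"
    unfolding int_span_insert[OF assms(1) notin] int_span_insert[OF assms(1,2)]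
  proof (intro subset_antisym subsetI)
    fix x assume "x \<in> {of_int k *\<^sub>R (t + y) + z | k z. z \<in> int_span S}"
    then obtain k z where x: "x = of_int k *\<^sub>R (t + y) + z" and z: "z \<in> int_span S" by blast
    have "x = of_int k *\<^sub>R t + (of_int k *\<^sub>R y + z)" by (simp add: x scaleR_add_right)
    moreover have "of_int k *\<^sub>R y + z \<in> int_span S" by (rule D(4)[OF scaled z])
    ultimately show "x \<in> {of_int k *\<^sub>R t + z | k z. z \<in> int_span S}" by blast
  next
    fix x assume "x \<in> {of_int k *\<^sub>R t + z | k z. z \<in> int_span S}"
    then obtain k z where x: "x = of_int k *\<^sub>R t + z" and z: "z \<in> int_span S" by blast
    have "x = of_int k *\<^sub>R (t + y) + (z - of_int k *\<^sub>R y)" by (simp add: x scaleR_add_right)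
    moreover have "z - of_int k *\<^sub>R y \<in> int_span S" by (rule D(2)[OF z scaled])
    ultimately show "x \<in> {of_int k *\<^sub>R (t + y) + z | k z. z \<in> int_span S}" by blast
  qed
qed

text \<open>The inductive step of the elementary divisor theorem.  Among all bases of the lattice and all elements of \<open>N\<close>,
  take the least positive coefficient \<open>d\<close> that occurs, say at the basis vector \<open>t\<close> of \<open>x = d t + y\<close>.  Division with
  remainder followed by a change of basis would turn any coefficient of \<open>y\<close> not divisible by \<open>d\<close> into a
  smaller positive one; so \<open>x = d m\<close> with \<open>m = t + y / d\<close>, and \<open>m\<close> can replace \<open>t\<close> in the basis.  Subtracting
  multiples of \<open>x\<close> shows in the same way that \<open>d\<close> divides the coefficient at \<open>m\<close> of every element of \<open>N\<close>.\<close>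

lemma minimal_coefficient_adapted_basis:
  fixes T :: "'a::real_vector set"
  assumes T: "finite T" "independent T" and N: "add_subgroup N" "N \<subseteq> int_span T" "N \<noteq> {0}"
  obtains d :: int and m S where "d > 0" "finite S" "m \<notin> S" "independent (insert m S)"
    "int_span (insert m S) = int_span T" "of_int d *\<^sub>R m \<in> N"
    "\<And>k z. of_int k *\<^sub>R m + z \<in> N \<Longrightarrow> z \<in> int_span S \<Longrightarrow> d dvd k"
proof -
  note ND = add_subgroupD[OF N(1)]
  define P where "P d \<longleftrightarrow> d > 0 \<and> (\<exists>t S y. finite S \<and> t \<notin> S \<and> independent (insert t S) \<and>
    int_span (insert t S) = int_span T \<and> y \<in> int_span S \<and> of_int (int d) *\<^sub>R t + y \<in> N)" for d
  have PI: "P (nat k)" if "k > 0" "finite S" "t \<notin> S" "independent (insert t S)"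
    "int_span (insert t S) = int_span T" "y \<in> int_span S" "of_int k *\<^sub>R t + y \<in> N" for k t S y
    unfolding P_def using that by (intro conjI exI[of _ t] exI[of _ S] exI[of _ y]) auto
  have "\<exists>d. P d"
  proof -
    obtain x where x: "x \<in> N" "x \<noteq> 0" using N(3) ND(1) by auto
    then obtain c where c: "x = (\<Sum>b\<in>T. of_int (c b) *\<^sub>R b)"
      using N(2) int_spanE[of x T] by blast
    with x obtain t where t: "t \<in> T" "c t \<noteq> 0" by (metis (no_types, lifting) of_int_0 scaleR_zero_left sum.neutral)
    let ?y = "\<Sum>b\<in>T - {t}. of_int (c b) *\<^sub>R b"
    have xt: "x = of_int (c t) *\<^sub>R t + ?y" unfolding c using T t by (simp add: sum.remove)
    have y: "?y \<in> int_span (T - {t})" by (rule int_spanI[OF refl])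
    have ins: "insert t (T - {t}) = T" using t by auto
    show ?thesis
    proof (cases "c t > 0")
      case True
      have "P (nat (c t))"
        by (rule PI[of _ "T - {t}" t ?y]) (use True T y ins xt x in auto)
      then show ?thesis ..
    next
      case False
      have "P (nat (- c t))"
      proof (rule PI[of _ "T - {t}" t "- ?y"])
        show "of_int (- c t) *\<^sub>R t + - ?y \<in> N" using ND(3)[OF x(1)] unfolding xt by simp
      qed (use False t T y ins add_subgroupD(3)[OF add_subgroup_int_span] in auto)
      then show ?thesis ..
    qed
  qed
  define e where "e = (LEAST d. P d)"
  have Pe: "P e" unfolding e_def using \<open>\<exists>d. P d\<close> by (rule LeastI_ex)
  have min: "\<not> P k" if "k < e" for k using not_less_Least that unfolding e_def by blast
  define d where "d = int e"
  obtain t S y where S: "finite S" "t \<notin> S" "independent (insert t S)"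
    "int_span (insert t S) = int_span T" and y: "y \<in> int_span S" and x: "of_int d *\<^sub>R t + y \<in> N"
    and d: "d > 0"
    using Pe unfolding P_def d_def by auto
  have small: False if "0 < r" "r < d" "finite S'" "t' \<notin> S'" "independent (insert t' S')"
    "int_span (insert t' S') = int_span T" "y' \<in> int_span S'" "of_int r *\<^sub>R t' + y' \<in> N" for r t' S' y'
    using PI[OF that(1,3-8)] min[of "nat r"] that(1,2) by (simp add: d_def nat_less_iff)
  obtain c where c: "y = (\<Sum>s\<in>S. of_int (c s) *\<^sub>R s)" using y by (rule int_spanE)
  have dvd: "d dvd c s" if s: "s \<in> S" for s
  proof (rule ccontr)
    assume nd: "\<not> d dvd c s"
    define q r where "q = c s div d" and "r = c s mod d"
    have cs: "c s = q * d + r" by (simp add: q_def r_def)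
    have r: "0 < r" "r < d"
      using nd pos_mod_bound[OF d] pos_mod_sign[OF d] by (auto simp: r_def dvd_eq_mod_eq_0 order_less_le)
    \<comment> \<open>\<open>d t + c s = d (t + q s) + r s\<close>, so in the new basis the remainder \<open>r\<close> is a coefficient at \<open>s\<close>.\<close>
    let ?t = "t + of_int q *\<^sub>R s" and ?S = "S - {s}"
    let ?y = "\<Sum>b\<in>?S. of_int (c b) *\<^sub>R b"
    have qs: "of_int q *\<^sub>R s \<in> int_span S"
      by (rule add_subgroup_scale_int[OF add_subgroup_int_span int_span_base[OF S(1) s]])
    note ex = int_span_basis_exchange[OF S(1-3) qs]
    have swap: "insert s (insert ?t ?S) = insert ?t S" using s by auto
    have notin: "?t \<notin> ?S" "s \<notin> insert ?t ?S" using ex(1) s by auto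
    show False
    proof (rule small[OF r, of "insert ?t ?S" s "of_int d *\<^sub>R ?t + ?y"])
      show "of_int d *\<^sub>R ?t + ?y \<in> int_span (insert ?t ?S)"
        unfolding int_span_insert[OF finite_Diff[OF S(1)] notin(1)] using int_spanI[OF refl] by blast
      have "y = of_int (c s) *\<^sub>R s + ?y" unfolding c using S(1) s by (simp add: sum.remove)
      then have "of_int r *\<^sub>R s + (of_int d *\<^sub>R ?t + ?y) = of_int d *\<^sub>R t + y"
        unfolding cs by (simp add: algebra_simps)
      then show "of_int r *\<^sub>R s + (of_int d *\<^sub>R ?t + ?y) \<in> N" using x by simp
    qed (use S swap notin ex in auto)
  qed
  define w where "w = (\<Sum>s\<in>S. of_int (c s div d) *\<^sub>R s)"
  have w: "w \<in> int_span S" unfolding w_def by (rule int_spanI[OF refl])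
  have "of_int (c s) *\<^sub>R s = of_int d *\<^sub>R (of_int (c s div d) *\<^sub>R s)" if "s \<in> S" for s
    using dvd[OF that] by (metis dvd_mult_div_cancel of_int_mult scaleR_scaleR)
  then have "y = of_int d *\<^sub>R w"
    unfolding c w_def scaleR_sum_right by (intro sum.cong) auto
  then have dm: "of_int d *\<^sub>R (t + w) \<in> N" using x by (simp add: scaleR_add_right)
  note ex = int_span_basis_exchange[OF S(1-3) w]
  show thesis
  proof (rule that[of d S "t + w"])
    show "int_span (insert (t + w) S) = int_span T" using ex(3) S(4) by simp
    show "d dvd k" if "of_int k *\<^sub>R (t + w) + z \<in> N" "z \<in> int_span S" for k z
    proof (rule ccontr)
      assume nd: "\<not> d dvd k"
      define q r where "q = k div d" and "r = k mod d"
      have k: "k = q * d + r" by (simp add: q_def r_def)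
      have r: "0 < r" "r < d"
      using nd pos_mod_bound[OF d] pos_mod_sign[OF d] by (auto simp: r_def dvd_eq_mod_eq_0 order_less_le)
      have "of_int k *\<^sub>R (t + w) + z - of_int q *\<^sub>R (of_int d *\<^sub>R (t + w)) \<in> N"
        by (rule ND(2)[OF that(1) add_subgroup_scale_int[OF N(1) dm]])
      then have "of_int r *\<^sub>R (t + w) + z \<in> N" unfolding k by (simp add: algebra_simps)
      then show False using small[OF r S(1) ex(1,2) _ that(2)] ex(3) S(4) by simp
    qed
  qed (use d S ex dm in auto)
qed

text \<open>The elementary divisor theorem, by induction on the rank: if \<open>d\<close> is the least positive coefficient, attained by
  \<open>d m\<close> in \<open>N\<close>, and \<open>S\<close> completes \<open>m\<close> to a basis, then \<open>N\<close> is the direct sum of \<open>\<int> d m\<close> and its intersection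
  with the integer span of \<open>S\<close>.  If \<open>N\<close> has smaller rank than the lattice, some of the multipliers are zero.\<close>

lemma stacked_basis:
  fixes T :: "'a::real_vector set"
  assumes "finite T" "independent T" "add_subgroup N" "N \<subseteq> int_span T"
  shows "\<exists>T' (d :: 'a \<Rightarrow> int). finite T' \<and> independent T' \<and> card T' = card T \<and>
    int_span T' = int_span T \<and> N = {\<Sum>b\<in>T'. of_int (c b * d b) *\<^sub>R b | c. True}"
  using assms
proof (induction "card T" arbitrary: T N)
  case 0
  then have "T = {}" by simp
  moreover have "N = {0}"
    using 0 add_subgroupD(1)[OF 0(4)] by (auto simp: \<open>T = {}\<close> int_span_def)
  ultimately show ?case by (intro exI[of _ "{}"]) (auto simp: independent_empty)
next
  case (Suc n)
  note T = Suc.prems(1,2) and N = Suc.prems(3,4)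
  show ?case
  proof (cases "N = {0}")
    case True
    have "N = {\<Sum>b\<in>T. of_int (c b * 0) *\<^sub>R b | c. True}" by (simp add: True)
    then show ?thesis using T by (intro exI[of _ T] exI[of _ "\<lambda>_. 0"] conjI) simp_all
  next
    case False
    obtain d m S where d: "d > 0" and S: "finite S" "m \<notin> S" "independent (insert m S)"
      "int_span (insert m S) = int_span T" and dm: "of_int d *\<^sub>R m \<in> N"
      and dvd: "\<And>k z. of_int k *\<^sub>R m + z \<in> N \<Longrightarrow> z \<in> int_span S \<Longrightarrow> d dvd k"
      by (rule minimal_coefficient_adapted_basis[OF T N False]) (rule that; assumption)
    have spans: "span (insert m S) = span T"
      using span_int_span[of "insert m S"] span_int_span[of T] S T by simp
    have card: "card (insert m S) = card T"
      using dim_eq_card[OF spans S(3)] dim_eq_card[OF refl T(2)] by simp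
    let ?N = "N \<inter> int_span S"
    have "add_subgroup ?N"
      using N(1) add_subgroup_int_span[of S] unfolding add_subgroup_def by blast
    moreover have "n = card S" using card Suc.hyps(2) S(1,2) by simp
    moreover have "independent S" using S(3) by (metis independent_mono subset_insertI)
    ultimately obtain S' f where S': "finite S'" "independent S'" "card S' = card S"
      "int_span S' = int_span S" and N': "?N = {\<Sum>b\<in>S'. of_int (c b * f b) *\<^sub>R b | c. True}"
      using Suc.hyps(1)[of S ?N] S(1) by blast
    have spS: "span S' = span S" using span_int_span[OF S'(1)] span_int_span[OF S(1)] S'(4) by simp
    have m: "m \<notin> span S'" using S(2,3) by (simp add: independent_insert spS)
    then have mS': "m \<notin> S'" using span_base by blast
    let ?T = "insert m S'" and ?d = "f(m := d)"
    have sum_eq: "(\<Sum>b\<in>?T. of_int (c b * ?d b) *\<^sub>R b) =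
        of_int (c m) *\<^sub>R (of_int d *\<^sub>R m) + (\<Sum>b\<in>S'. of_int (c b * f b) *\<^sub>R b)" for c
    proof -
      have "(\<Sum>b\<in>S'. of_int (c b * ?d b) *\<^sub>R b) = (\<Sum>b\<in>S'. of_int (c b * f b) *\<^sub>R b)"
        by (rule sum.cong) (use mS' in auto)
      then show ?thesis using S'(1) mS' by simp
    qed
    have "N = {\<Sum>b\<in>?T. of_int (c b * ?d b) *\<^sub>R b | c. True}"
    proof (intro Set.set_eqI iffI)
      fix x assume x: "x \<in> N"
      then have "x \<in> int_span (insert m S)" using N(2) S(4) by auto
      then obtain k z where xz: "x = of_int k *\<^sub>R m + z" "z \<in> int_span S"
        unfolding int_span_insert[OF S(1,2)] by blast
      then obtain q where k: "k = d * q" using dvd x by (meson dvdE)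
      have "x - of_int q *\<^sub>R (of_int d *\<^sub>R m) \<in> N"
        by (rule add_subgroupD(2)[OF N(1) x add_subgroup_scale_int[OF N(1) dm]])
      then have "z \<in> ?N" using xz by (simp add: k mult.commute)
      then obtain c where "z = (\<Sum>b\<in>S'. of_int (c b * f b) *\<^sub>R b)" unfolding N' by blast
      moreover have "(\<Sum>b\<in>S'. of_int ((c(m := q)) b * f b) *\<^sub>R b) = (\<Sum>b\<in>S'. of_int (c b * f b) *\<^sub>R b)"
        by (rule sum.cong) (use mS' in auto)
      ultimately have "x = (\<Sum>b\<in>?T. of_int ((c(m := q)) b * ?d b) *\<^sub>R b)"
        unfolding sum_eq xz k by (simp add: mult.commute)
      then show "x \<in> {\<Sum>b\<in>?T. of_int (c b * ?d b) *\<^sub>R b | c. True}" by blast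
    next
      fix x assume "x \<in> {\<Sum>b\<in>?T. of_int (c b * ?d b) *\<^sub>R b | c. True}"
      then obtain c where "x = of_int (c m) *\<^sub>R (of_int d *\<^sub>R m) + (\<Sum>b\<in>S'. of_int (c b * f b) *\<^sub>R b)"
        unfolding sum_eq by blast
      moreover have "(\<Sum>b\<in>S'. of_int (c b * f b) *\<^sub>R b) \<in> ?N" unfolding N' by blast
      ultimately show "x \<in> N"
        using add_subgroup_scale_int[OF N(1) dm] add_subgroupD(4)[OF N(1)] by auto
    qed
    moreover have "int_span ?T = int_span T"
      unfolding S(4)[symmetric] int_span_insert[OF S(1,2)] int_span_insert[OF S'(1) mS'] S'(4) ..
    moreover have "independent ?T" using S'(2) m mS' by (simp add: independent_insert)
    moreover have "card ?T = card T" using card S(1,2) S'(1,3) mS' by simp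
    ultimately show ?thesis using S'(1) by (intro exI[of _ ?T] exI[of _ ?d] conjI) simp_all
  qed
qed

section \<open>Complexification of real linear maps\<close>

definition Re_vec :: "complex ^ 'n \<Rightarrow> real ^ 'n" where "Re_vec z = (\<chi> i. Re (z $ i))"
definition Im_vec :: "complex ^ 'n \<Rightarrow> real ^ 'n" where "Im_vec z = (\<chi> i. Im (z $ i))"

definition complexify :: "(real ^ 'n \<Rightarrow> real ^ 'm) \<Rightarrow> complex ^ 'n \<Rightarrow> complex ^ 'm" where
  "complexify A z = cvec (A (Re_vec z)) + \<i> *s cvec (A (Im_vec z))"

lemma clinearI:
  assumes "\<And>x y. F (x + y) = F x + F y" "\<And>c x. F (c *s x) = c *s F x"
  shows "clinear F"
  using assms by (simp add: Vector_Spaces.linear_iff vec.vector_space_axioms)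

lemma clinearD:
  assumes "clinear F"
  shows "F (x + y) = F x + F y" "F (c *s x) = c *s F x" "F (x - y) = F x - F y" "F 0 = 0"
proof -
  show add: "F (x + y) = F x + F y" and "F (c *s x) = c *s F x" for x y c
    using assms by (auto simp: Vector_Spaces.linear_iff)
  show "F (x - y) = F x - F y" using add[of "x - y" y] by simp
  show "F 0 = 0" using add[of 0 0] by simp
qed

lemma of_real_vector_scale: "complex_of_real r *s x = r *\<^sub>R x"
  by (simp add: vec_eq_iff) (simp add: scaleR_conv_of_real)

lemma clinear_imp_linear:
  assumes "clinear F"
  shows "linear F"
  by (rule linearI) (simp_all add: clinearD[OF assms] flip: of_real_vector_scale)

lemma cvec_simps:
  "cvec (u + v) = cvec u + cvec v" "cvec (u - v) = cvec u - cvec v" "cvec 0 = 0"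
  "cvec (r *\<^sub>R u) = r *\<^sub>R cvec u"
  by (simp_all add: cvec_def vec_eq_iff) (simp add: scaleR_conv_of_real)

lemma linear_cvec: "linear cvec"
  by (rule linearI) (simp_all add: cvec_simps)

lemma cvec_inject: "cvec u = cvec v \<longleftrightarrow> u = v"
  by (simp add: cvec_def vec_eq_iff)

lemma Re_vec_add: "Re_vec (x + y) = Re_vec x + Re_vec y"
  and Im_vec_add: "Im_vec (x + y) = Im_vec x + Im_vec y"
  and Re_vec_scale: "Re_vec (c *s x) = Re c *\<^sub>R Re_vec x - Im c *\<^sub>R Im_vec x"
  and Im_vec_scale: "Im_vec (c *s x) = Re c *\<^sub>R Im_vec x + Im c *\<^sub>R Re_vec x"
  and Re_vec_cvec: "Re_vec (cvec u) = u"
  and Im_vec_cvec: "Im_vec (cvec u) = 0"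
  by (simp_all add: Re_vec_def Im_vec_def cvec_def vec_eq_iff)

lemmas Re_Im_vec_simps = Re_vec_add Im_vec_add Re_vec_scale Im_vec_scale Re_vec_cvec Im_vec_cvec

lemma cvec_Re_Im_vec: "z = cvec (Re_vec z) + \<i> *s cvec (Im_vec z)"
  by (simp add: Re_vec_def Im_vec_def cvec_def vec_eq_iff complex_eq_iff)

text \<open>The splitting of \<open>V\<close> into \<open>U\<close> and \<open>\<tau> U\<close>, which reduces computations on \<open>X(B, \<tau>)\<close> to pairs of real vectors.\<close>

lemma tau_coordinates:
  fixes \<tau> :: complex
  assumes "Im \<tau> \<noteq> 0"
  shows "linear (\<lambda>(u, v). cvec u + \<tau> *s cvec v)" "bij (\<lambda>(u, v). cvec u + \<tau> *s cvec v)"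
proof -
  show "linear (\<lambda>(u, v). cvec u + \<tau> *s cvec v)"
    by (rule linearI)
       (auto simp: cvec_simps vec.scale_right_distrib scaleR_add_right algebra_simps simp flip: of_real_vector_scale)
  show "bij (\<lambda>(u, v). cvec u + \<tau> *s cvec v)"
  proof (rule bijI)
    show "inj (\<lambda>(u, v). cvec u + \<tau> *s cvec v)"
    proof (rule injI, clarify)
      fix u v u' v'
      assume eq: "cvec u + \<tau> *s cvec v = cvec u' + \<tau> *s cvec v'"
      have "v = v'" using arg_cong[OF eq, of Im_vec] assms by (simp add: Re_Im_vec_simps)
      moreover have "u = u'" using arg_cong[OF eq, of Re_vec] \<open>v = v'\<close> by (simp add: Re_Im_vec_simps)
      ultimately show "u = u' \<and> v = v'" by simp
    qed
    have "z \<in> range (\<lambda>(u, v). cvec u + \<tau> *s cvec v)" for z :: "complex ^ 'n"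
    proof -
      let ?v = "(1 / Im \<tau>) *\<^sub>R Im_vec z"
      let ?u = "Re_vec z - Re \<tau> *\<^sub>R ?v"
      have "z = cvec ?u + \<tau> *s cvec ?v"
        using assms by (simp add: vec_eq_iff cvec_def Re_vec_def Im_vec_def complex_eq_iff)
      then show ?thesis by (auto intro: range_eqI[of _ _ "(?u, ?v)"])
    qed
    then show "range (\<lambda>(u, v). cvec u + \<tau> *s cvec v) = UNIV" by auto
  qed
qed

lemma tau_coordinates_cases:
  assumes "Im \<tau> \<noteq> 0"
  obtains u v where "z = cvec u + \<tau> *s cvec v"
  using bij_is_surj[OF tau_coordinates(2)[OF assms]] by (metis (no_types, lifting) case_prod_beta surjD)

lemma tau_coordinates_inject:
  assumes "Im \<tau> \<noteq> 0"
  shows "cvec u + \<tau> *s cvec v = cvec u' + \<tau> *s cvec v' \<longleftrightarrow> u = u' \<and> v = v'"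
  using inj_eq[OF bij_is_inj[OF tau_coordinates(2)[OF assms]], of "(u, v)" "(u', v')"] by simp

lemma clinear_complexify:
  assumes "linear A"
  shows "clinear (complexify A)"
proof (rule clinearI)
  show "complexify A (x + y) = complexify A x + complexify A y" for x y
    by (simp add: complexify_def Re_Im_vec_simps linear_add[OF assms] cvec_simps vec.scale_right_distrib)
  show "complexify A (c *s x) = c *s complexify A x" for c x
    by (simp add: complexify_def Re_Im_vec_simps linear_add[OF assms] linear_diff[OF assms]
        linear_cmul[OF assms] vec_eq_iff cvec_def complex_eq_iff algebra_simps)
qed

lemma complexify_cvec:
  assumes "linear A"
  shows "complexify A (cvec u) = cvec (A u)"
  by (simp add: complexify_def Re_Im_vec_simps linear_0[OF assms] cvec_simps)

lemma complexify_tau: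
  assumes "linear A"
  shows "complexify A (cvec u + \<tau> *s cvec v) = cvec (A u) + \<tau> *s cvec (A v)"
  by (simp add: clinearD[OF clinear_complexify[OF assms]] complexify_cvec[OF assms])

lemma complexify_o: "complexify A \<circ> complexify A' = complexify (A \<circ> A')"
  unfolding complexify_def[of A', abs_def]
  by (simp add: fun_eq_iff Re_Im_vec_simps complexify_def)

lemma complexify_bij:
  assumes "bij A"
  shows "bij (complexify A)"
proof (rule o_bij)
  have id: "complexify id = id"
    by (simp add: fun_eq_iff complexify_def flip: cvec_Re_Im_vec)
  have "inv_into UNIV A \<circ> A = id" "A \<circ> inv_into UNIV A = id"
    using assms by (auto simp: fun_eq_iff bij_is_inj bij_is_surj surj_f_inv_f)
  then show "complexify (inv_into UNIV A) \<circ> complexify A = id"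
    "complexify A \<circ> complexify (inv_into UNIV A) = id"
    by (simp_all add: complexify_o id)
qed

text \<open>A lattice of \<open>U\<close> spans \<open>U\<close> over the reals and hence \<open>V\<close> over the complex numbers.\<close>

lemma clinear_eq_on_lattice:
  fixes F G :: "complex ^ 'n \<Rightarrow> complex ^ 'm"
  assumes L: "full_lattice L" and FG: "clinear F" "clinear G" "\<And>l. l \<in> L \<Longrightarrow> F (cvec l) = G (cvec l)"
  shows "F = G"
proof
  fix z
  have "(F \<circ> cvec) u = (G \<circ> cvec) u" for u
    by (rule linear_eq_on_span[of "F \<circ> cvec" "G \<circ> cvec" L])
       (use FG full_lattice_span[OF L] in \<open>auto intro!: linear_compose[OF linear_cvec] clinear_imp_linear\<close>)
  then have "F (cvec (Re_vec z) + \<i> *s cvec (Im_vec z)) = G (cvec (Re_vec z) + \<i> *s cvec (Im_vec z))"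
    by (simp add: clinearD[OF FG(1)] clinearD[OF FG(2)])
  then show "F z = G z" by (simp flip: cvec_Re_Im_vec)
qed

lemma complex_extension_eq:
  assumes "full_lattice L" "linear A" "\<And>l. l \<in> L \<Longrightarrow> A l = f l"
  shows "complex_extension L f = complexify A"
  unfolding complex_extension_def
proof (rule the_equality)
  show "clinear (complexify A) \<and> (\<forall>l\<in>L. complexify A (cvec l) = cvec (f l))"
    using assms by (simp add: clinear_complexify complexify_cvec)
  then show "F = complexify A" if "clinear F \<and> (\<forall>l\<in>L. F (cvec l) = cvec (f l))" for F
    using clinear_eq_on_lattice[OF assms(1), of F "complexify A"] that by simp
qed

lemma additive_on_linear_extension:
  fixes f :: "'a::euclidean_space \<Rightarrow> 'b::real_vector"
  assumes "full_lattice L" "additive_on L f"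
  obtains A where "linear A" "\<And>l. l \<in> L \<Longrightarrow> A l = f l"
proof -
  obtain S where S: "finite S" "independent S" "span S = UNIV" "L = int_span S"
    using assms(1) by (auto simp: full_lattice_def)
  obtain A where A: "linear A" "\<And>s. s \<in> S \<Longrightarrow> A s = f s"
    using linear_independent_extend[OF S(2), of f] by blast
  have "A l = f l" if l: "l \<in> L" for l
  proof -
    obtain c where c: "l = (\<Sum>b\<in>S. of_int (c b) *\<^sub>R b)" using l unfolding S(4) by (rule int_spanE)
    have "f l = (\<Sum>b\<in>S. of_int (c b) *\<^sub>R f b)"
      unfolding c
      by (rule additive_on_linear_combination[OF full_lattice_add_subgroup[OF assms(1)] assms(2)])
         (use S int_span_base in auto)
    then show ?thesis
      unfolding c by (simp add: linear_sum[OF A(1)] linear_cmul[OF A(1)] A(2))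
  qed
  with A(1) that show thesis by blast
qed

lemma real_extension_eq:
  assumes "full_lattice L" "linear A" "\<And>l. l \<in> L \<Longrightarrow> A l = f l"
  shows "real_extension L f = A"
  unfolding real_extension_def
proof (rule the_equality)
  show "F = A" if "linear F \<and> (\<forall>l\<in>L. F l = f l)" for F
    by (rule ext, rule linear_eq_on_span[of F A L])
       (use that assms full_lattice_span[OF assms(1)] in auto)
qed (use assms in auto)

section \<open>Homomorphisms of tori induced by linear maps\<close>

lemma coset_eq_iff:
  assumes "add_subgroup \<Lambda>"
  shows "v +o \<Lambda> = w +o \<Lambda> \<longleftrightarrow> v - w \<in> \<Lambda>"
proof
  note D = add_subgroupD[OF assms]
  assume eq: "v +o \<Lambda> = w +o \<Lambda>"
  have "v \<in> v +o \<Lambda>" using D(1) by (auto simp: elt_set_plus_def)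
  then obtain l where "v = w + l" "l \<in> \<Lambda>" unfolding eq by (auto simp: elt_set_plus_def)
  then show "v - w \<in> \<Lambda>" by simp
next
  note D = add_subgroupD[OF assms]
  assume vw: "v - w \<in> \<Lambda>"
  have "v + l = w + ((v - w) + l)" "w + l = v + (l - (v - w))" for l by simp_all
  moreover have "l \<in> \<Lambda> \<Longrightarrow> (v - w) + l \<in> \<Lambda>" "l \<in> \<Lambda> \<Longrightarrow> l - (v - w) \<in> \<Lambda>" for l
    using vw D by auto
  ultimately show "v +o \<Lambda> = w +o \<Lambda>" unfolding elt_set_plus_def by blast
qed

lemma coset_add:
  assumes "add_subgroup \<Lambda>"
  shows "(v +o \<Lambda>) + (w +o \<Lambda>) = (v + w) +o \<Lambda>"
proof -
  have "\<Lambda> + \<Lambda> = \<Lambda>"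
    using add_subgroupD[OF assms] by (force simp: set_plus_def)
  then show ?thesis by (simp add: set_plus_rearrange)
qed

lemma elt_set_plus_image: "v +o S = (\<lambda>x. v + x) ` S"
  by (auto simp: elt_set_plus_def)

lemma clinear_image_coset:
  assumes "clinear A"
  shows "A ` (v +o \<Lambda>) = A v +o A ` \<Lambda>"
  by (simp add: elt_set_plus_image image_image clinearD[OF assms])

lemma clinear_inv:
  assumes "clinear A" "bij A"
  shows "clinear (inv_into UNIV A)"
proof (rule clinearI)
  have A: "A (inv_into UNIV A x) = x" for x using assms(2) by (simp add: bij_is_surj surj_f_inv_f)
  note eqI = injD[OF bij_is_inj[OF assms(2)]]
  show "inv_into UNIV A (x + y) = inv_into UNIV A x + inv_into UNIV A y" for x y
    by (rule eqI) (simp add: A clinearD[OF assms(1)])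
  show "inv_into UNIV A (c *s x) = c *s inv_into UNIV A x" for c x
    by (rule eqI) (simp add: A clinearD[OF assms(1)])
qed

lemma torus_hom_induced:
  assumes \<Lambda>: "add_subgroup \<Lambda>" "add_subgroup \<Lambda>'" and A: "clinear A"
    and f: "\<And>v. f (v +o \<Lambda>) = A v +o \<Lambda>'"
  shows "torus_hom \<Lambda> \<Lambda>' f"
  unfolding torus_hom_def
proof (intro conjI ballI)
  show "f \<in> torus \<Lambda> \<rightarrow> torus \<Lambda>'" using f by (auto simp: torus_def)
  show "f (P + Q) = f P + f Q" if "P \<in> torus \<Lambda>" "Q \<in> torus \<Lambda>" for P Q
    using that by (auto simp: torus_def coset_add[OF \<Lambda>(1)] coset_add[OF \<Lambda>(2)] f clinearD[OF A])
  have "(A has_derivative A) (at w)" for w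
    by (rule linear_imp_has_derivative[OF clinear_imp_linear[OF A]])
  then show "torus_holomorphic \<Lambda> \<Lambda>' f"
    unfolding torus_holomorphic_def
    by (intro allI exI[of _ UNIV] exI[of _ A]) (use A f in auto)
qed

lemma torus_iso_induced:
  assumes \<Lambda>: "add_subgroup \<Lambda>" "add_subgroup \<Lambda>'" and A: "clinear A" "bij A" "A ` \<Lambda> = \<Lambda>'"
    and f: "\<And>v. f (v +o \<Lambda>) = A v +o \<Lambda>'"
  shows "torus_iso \<Lambda> \<Lambda>' f"
proof -
  have "inj_on f (torus \<Lambda>)"
  proof (rule inj_onI)
    fix P Q assume PQ: "P \<in> torus \<Lambda>" "Q \<in> torus \<Lambda>" "f P = f Q"
    have "f P = A ` P" if P: "P \<in> torus \<Lambda>" for P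
    proof -
      obtain v where "P = v +o \<Lambda>" using P by (auto simp: torus_def)
      then show ?thesis by (simp only: f clinear_image_coset[OF A(1)] A(3))
    qed
    with PQ have "A ` P = A ` Q" by metis
    then show "P = Q" by (simp add: inj_image_eq_iff[OF bij_is_inj[OF A(2)]])
  qed
  moreover have "f ` torus \<Lambda> = torus \<Lambda>'"
  proof -
    have "f ` torus \<Lambda> = (\<lambda>w. w +o \<Lambda>') ` range A" by (auto simp: torus_def f image_image)
    then show ?thesis using bij_is_surj[OF A(2)] by (simp add: torus_def)
  qed
  ultimately have bij: "bij_betw f (torus \<Lambda>) (torus \<Lambda>')" by (simp add: bij_betw_def)
  have "inv_into (torus \<Lambda>) f (w +o \<Lambda>') = inv_into UNIV A w +o \<Lambda>" for w
  proof (rule inv_into_f_eq[OF \<open>inj_on f (torus \<Lambda>)\<close>])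
    show "inv_into UNIV A w +o \<Lambda> \<in> torus \<Lambda>" by (simp add: torus_def)
    show "f (inv_into UNIV A w +o \<Lambda>) = w +o \<Lambda>'" using A(2) by (simp add: f bij_is_surj surj_f_inv_f)
  qed
  then show ?thesis
    unfolding torus_iso_def
    using bij torus_hom_induced[OF \<Lambda> A(1) f] torus_hom_induced[OF \<Lambda>(2,1) clinear_inv[OF A(1,2)]]
    by blast
qed

lemma analytic_rep_induced:
  assumes \<Lambda>: "full_lattice \<Lambda>" and A: "clinear A" and f: "\<And>v. f (v +o \<Lambda>) = A v +o \<Lambda>"
  shows "analytic_rep \<Lambda> f = A"
  unfolding analytic_rep_def
proof (rule the_equality)
  fix F assume F: "clinear F \<and> (\<forall>v. f (v +o \<Lambda>) = F v +o \<Lambda>)"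
  show "F = A"
  proof
    fix v
    have "r *\<^sub>R (F v - A v) \<in> \<Lambda>" for r
    proof -
      have "F (r *\<^sub>R v) +o \<Lambda> = A (r *\<^sub>R v) +o \<Lambda>" using F f by metis
      then have "F (r *\<^sub>R v) - A (r *\<^sub>R v) \<in> \<Lambda>"
        by (simp add: coset_eq_iff[OF full_lattice_add_subgroup[OF \<Lambda>]])
      then show ?thesis
        using F A by (simp add: linear_cmul[OF clinear_imp_linear] scaleR_diff_right)
    qed
    then have "F v - A v = 0" by (rule full_lattice_no_line[OF \<Lambda>])
    then show "F v = A v" by simp
  qed
qed (use A f in auto)

section \<open>Inner products and dual lattices\<close>

lemma inner_productD:
  assumes "inner_product B"
  shows "bilinear B" "B u v = B v u" "u \<noteq> 0 \<Longrightarrow> B u u > 0"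
  using assms by (auto simp: inner_product_def)

text \<open>The Riesz representation theorem in finite dimension: by definiteness, the map that sends \<open>m\<close> to the values of
  \<open>B m\<close> on the standard basis is injective, and thus surjective.\<close>

lemma inner_product_represents_functional:
  fixes g :: "'a::euclidean_space \<Rightarrow> real"
  assumes B: "inner_product B" and g: "linear g"
  obtains m where "\<And>u. B m u = g u"
proof -
  note BD = inner_productD[OF B]
  have lin: "linear (B m)" "linear (\<lambda>m. B m u)" for m u
    using BD(1) by (auto simp: bilinear_def)
  define \<Phi> where "\<Phi> m = (\<Sum>b\<in>Basis. B m b *\<^sub>R b)" for m
  have \<Phi>: "linear \<Phi>"
    unfolding \<Phi>_def
    by (rule linearI)
       (simp_all add: bilinear_ladd[OF BD(1)] bilinear_lmul[OF BD(1)] scaleR_add_left sum.distrib scaleR_sum_right)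
  have eqI: "B m = h" if "\<And>b. b \<in> Basis \<Longrightarrow> B m b = h b" "linear h" for m h
    using linear_eq_stdbasis[OF lin(1) that(2)] that(1) by blast
  have "m = 0" if "\<Phi> m = 0" for m
  proof (rule ccontr)
    assume "m \<noteq> 0"
    have "B m b = 0" if "b \<in> Basis" for b
    proof -
      have "B m b = \<Phi> m \<bullet> b" using that by (simp add: \<Phi>_def)
      then show ?thesis by (simp add: \<open>\<Phi> m = 0\<close>)
    qed
    then have "B m = (\<lambda>_. 0)" by (intro eqI) (auto intro: linear_zero)
    then show False using BD(3)[OF \<open>m \<noteq> 0\<close>] by simp
  qed
  then have "inj \<Phi>" using linear_injective_0[OF \<Phi>] by blast
  then have "surj \<Phi>" using linear_injective_imp_surjective[OF \<Phi>] by simp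
  then obtain m where m: "\<Phi> m = (\<Sum>b\<in>Basis. g b *\<^sub>R b)" by (metis surjD)
  have "B m b = g b" if "b \<in> Basis" for b
  proof -
    have "B m b = \<Phi> m \<bullet> b" using that by (simp add: \<Phi>_def)
    also have "\<dots> = g b" using that by (simp add: m)
    finally show ?thesis .
  qed
  then have "B m = g" using eqI g by blast
  then show thesis using that by auto
qed

lemma inner_product_eqI:
  fixes L :: "'a::euclidean_space set"
  assumes B: "inner_product B" and L: "span L = UNIV" and eq: "\<And>l. l \<in> L \<Longrightarrow> B a l = B b l"
  shows "a = b"
proof (rule ccontr)
  note BD = inner_productD[OF B]
  assume "a \<noteq> b"
  have "B a (a - b) = B b (a - b)"
    by (rule linear_eq_on_span[of "B a" "B b" L])
       (use BD(1) L eq in \<open>auto simp: bilinear_def\<close>)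
  then have "B (a - b) (a - b) = 0" by (simp add: bilinear_lsub[OF BD(1)])
  then show False using BD(3)[of "a - b"] \<open>a \<noteq> b\<close> by simp
qed

lemma add_subgroup_dual_lattice:
  assumes "inner_product B"
  shows "add_subgroup (dual_lattice B L)"
  using inner_productD(1)[OF assms]
  by (auto simp: add_subgroup_def dual_lattice_def bilinear_lzero bilinear_lsub)

text \<open>The vectors \<open>s' s\<close> represent the coordinate functionals of \<open>S\<close>, so \<open>u\<close> expands as the sum of the \<open>B u s\<close> times
  \<open>s' s\<close>, and lies in the dual lattice iff these coefficients are integers.\<close>

lemma dual_basis:
  fixes S :: "'a::euclidean_space set"
  assumes B: "inner_product B" and S: "finite S" "independent S" "span S = UNIV"
  obtains s' where "\<And>s u. B (s' s) u = representation S u s"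
    "dual_lattice B (int_span S) = int_span (s' ` S)" "span (s' ` S) = UNIV"
proof -
  note BD = inner_productD[OF B]
  have "linear (\<lambda>u. representation S u s)" for s
    by (rule linearI) (use S in \<open>simp_all add: representation_add representation_scale\<close>)
  then have "\<exists>m. \<forall>u. B m u = representation S u s" for s
    using inner_product_represents_functional[OF B] by metis
  then obtain s' where s': "\<And>s u. B (s' s) u = representation S u s" by metis
  have expand: "u = (\<Sum>s\<in>S. B u s *\<^sub>R s' s)" for u
  proof (rule inner_product_eqI[OF B S(3)])
    fix t assume t: "t \<in> S"
    have "B (\<Sum>s\<in>S. B u s *\<^sub>R s' s) t = (\<Sum>s\<in>S. B u s * B (s' s) t)"
      using BD(1) by (simp add: bilinear_def linear_sum[of "\<lambda>x. B x t"] linear_cmul[of "\<lambda>x. B x t"])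
    also have "\<dots> = (\<Sum>s\<in>S. if s = t then B u s else 0)"
      by (rule sum.cong) (use S t in \<open>auto simp: s' representation_basis\<close>)
    finally show "B u t = B (\<Sum>s\<in>S. B u s *\<^sub>R s' s) t" using S(1) t by simp
  qed
  have "dual_lattice B (int_span S) = int_span (s' ` S)"
  proof
    have "s' ` S \<subseteq> dual_lattice B (int_span S)"
      using int_span_iff_representation[OF S(1,2)] S(3) by (auto simp: dual_lattice_def s')
    then show "int_span (s' ` S) \<subseteq> dual_lattice B (int_span S)"
      by (rule int_span_minimal[OF add_subgroup_dual_lattice[OF B]])
    show "dual_lattice B (int_span S) \<subseteq> int_span (s' ` S)"
    proof
      fix u assume "u \<in> dual_lattice B (int_span S)"
      then have "B u s \<in> \<int>" if "s \<in> S" for s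
        using int_span_base[OF S(1) that] by (auto simp: dual_lattice_def)
      then have "(\<Sum>s\<in>S. B u s *\<^sub>R s' s) \<in> int_span (s' ` S)"
        by (intro add_subgroup_sum[OF add_subgroup_int_span])
           (auto intro: add_subgroup_scale_Ints[OF add_subgroup_int_span
              int_span_base[OF finite_imageI[OF S(1)]]])
      then show "u \<in> int_span (s' ` S)" using expand[of u] by simp
    qed
  qed
  moreover have "u \<in> span (s' ` S)" for u
    by (subst expand) (auto intro!: span_sum span_scale intro: span_base)
  ultimately show thesis using that s' by blast
qed

lemma full_lattice_dual:
  fixes L :: "'a::euclidean_space set"
  assumes B: "inner_product B" and L: "full_lattice L"
  shows "full_lattice (dual_lattice B L)"
proof -
  obtain S where S: "finite S" "independent S" "span S = UNIV" "L = int_span S"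
    using L by (auto simp: full_lattice_def)
  obtain s' where s': "dual_lattice B (int_span S) = int_span (s' ` S)" "span (s' ` S) = UNIV"
    using dual_basis[OF B S(1-3)] by metis
  have "card (s' ` S) \<le> DIM('a)"
    using card_image_le[OF S(1), of s'] basis_card_eq_dim[of S UNIV] S by (simp add: dim_UNIV)
  then show ?thesis
    unfolding S(4) s'(1) using full_lattice_int_span[of "s' ` S"] S(1) s'(2) by blast
qed

text \<open>An element of the bidual has integral coordinates, since its coordinates are its products with the dual basis.\<close>

lemma dual_dual_lattice:
  fixes L :: "'a::euclidean_space set"
  assumes B: "inner_product B" and L: "full_lattice L"
  shows "dual_lattice B (dual_lattice B L) = L"
proof
  note BD = inner_productD[OF B]
  show "L \<subseteq> dual_lattice B (dual_lattice B L)"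
    by (auto simp: dual_lattice_def) (metis BD(2))
  obtain S where S: "finite S" "independent S" "span S = UNIV" "L = int_span S"
    using L by (auto simp: full_lattice_def)
  obtain s' where s': "\<And>s u. B (s' s) u = representation S u s"
    "dual_lattice B (int_span S) = int_span (s' ` S)"
    using dual_basis[OF B S(1-3)] by metis
  show "dual_lattice B (dual_lattice B L) \<subseteq> L"
  proof
    fix u assume u: "u \<in> dual_lattice B (dual_lattice B L)"
    have "representation S u s \<in> \<int>" if "s \<in> S" for s
    proof -
      have "s' s \<in> dual_lattice B L"
        unfolding S(4) s'(2) by (rule int_span_base) (use S(1) that in auto)
      then have "B u (s' s) \<in> \<int>" using u by (auto simp: dual_lattice_def)
      then show ?thesis by (simp add: BD(2)[of u] s'(1))
    qed
    then show "u \<in> L" using int_span_iff_representation[OF S(1,2), of u] S(3,4) by auto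
  qed
qed

section \<open>The polarization\<close>

text \<open>The form \<open>B(conj x, y) / Im \<tau>\<close>, where \<open>B\<close> is extended complex bilinearly to \<open>V\<close>.\<close>

definition X_hermitian :: "(real ^ 'n \<Rightarrow> real ^ 'n \<Rightarrow> real) \<Rightarrow> complex \<Rightarrow> complex ^ 'n \<Rightarrow> complex ^ 'n \<Rightarrow> complex" where
  "X_hermitian B \<tau> x y =
     Complex ((B (Re_vec x) (Re_vec y) + B (Im_vec x) (Im_vec y)) / Im \<tau>)
             ((B (Re_vec x) (Im_vec y) - B (Im_vec x) (Re_vec y)) / Im \<tau>)"

lemma X_form_X_hermitian:
  assumes B: "inner_product B" and \<tau>: "Im \<tau> \<noteq> 0"
  shows "X_form B \<tau> (X_hermitian B \<tau>)"
proof -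
  note BD = inner_productD[OF B]
  note bil = bilinear_ladd[OF BD(1)] bilinear_radd[OF BD(1)] bilinear_lmul[OF BD(1)] bilinear_rmul[OF BD(1)]
    bilinear_lsub[OF BD(1)] bilinear_rsub[OF BD(1)] bilinear_lzero[OF BD(1)] bilinear_rzero[OF BD(1)]
  show ?thesis
    unfolding X_form_def hermitian_form_def
  proof (intro conjI allI)
    show "X_hermitian B \<tau> x (y + z) = X_hermitian B \<tau> x y + X_hermitian B \<tau> x z" for x y z
      using \<tau> by (simp add: X_hermitian_def complex_eq_iff Re_Im_vec_simps bil field_simps)
    show "X_hermitian B \<tau> x (c *s y) = c * X_hermitian B \<tau> x y" for x y c
      using \<tau> by (simp add: X_hermitian_def complex_eq_iff Re_Im_vec_simps bil field_simps)
    show "X_hermitian B \<tau> y x = cnj (X_hermitian B \<tau> x y)" for x y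
      using BD(2)[of "Re_vec y" "Re_vec x"] BD(2)[of "Im_vec y" "Im_vec x"]
        BD(2)[of "Re_vec y" "Im_vec x"] BD(2)[of "Im_vec y" "Re_vec x"]
      by (simp add: X_hermitian_def complex_eq_iff minus_divide_left)
    show "Im (X_hermitian B \<tau> (cvec u + \<tau> *s cvec u') (cvec v + \<tau> *s cvec v')) = B u v' - B v u'" for u u' v v'
    proof -
      have "Im (X_hermitian B \<tau> (cvec u + \<tau> *s cvec u') (cvec v + \<tau> *s cvec v')) =
          (Im \<tau> * (B u v' - B u' v)) / Im \<tau>"
        unfolding X_hermitian_def Re_Im_vec_simps by (simp add: bil algebra_simps)
      then show ?thesis using \<tau> BD(2)[of v u'] by simp
    qed
  qed
qed

text \<open>Complex linearity in the second variable gives \<open>Re H(x, y) = Im H(x, i y)\<close>.\<close>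

lemma hermitian_form_eqI:
  assumes "hermitian_form H" "hermitian_form H'" "\<And>x y. Im (H x y) = Im (H' x y)"
  shows "H = H'"
proof (intro ext complex_eqI)
  fix x y
  have "H x (\<i> *s y) = \<i> * H x y" "H' x (\<i> *s y) = \<i> * H' x y"
    using assms(1,2) unfolding hermitian_form_def by blast+
  then have "Re (H x y) = Im (H x (\<i> *s y))" "Re (H' x y) = Im (H' x (\<i> *s y))" by simp_all
  then show "Re (H x y) = Re (H' x y)" using assms(3) by simp
qed (rule assms(3))

lemma X_form_unique:
  fixes B :: "real ^ 'n \<Rightarrow> real ^ 'n \<Rightarrow> real"
  assumes "Im \<tau> \<noteq> 0" "X_form B \<tau> H" "X_form B \<tau> H'"
  shows "H = H'"
proof (rule hermitian_form_eqI)
  fix x y :: "complex ^ 'n"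
  obtain u u' where x: "x = cvec u + \<tau> *s cvec u'" by (rule tau_coordinates_cases[OF assms(1)])
  obtain v v' where y: "y = cvec v + \<tau> *s cvec v'" by (rule tau_coordinates_cases[OF assms(1)])
  show "Im (H x y) = Im (H' x y)" using assms(2,3) by (simp add: X_form_def x y)
qed (use assms in \<open>auto simp: X_form_def\<close>)

lemma X_form_Im:
  "X_form B \<tau> H \<Longrightarrow> Im (H (cvec u + \<tau> *s cvec u') (cvec v + \<tau> *s cvec v')) = B u v' - B v u'"
  by (simp add: X_form_def)

lemma X_form_pos_def:
  fixes B :: "real ^ 'n \<Rightarrow> real ^ 'n \<Rightarrow> real"
  assumes B: "inner_product B" and \<tau>: "Im \<tau> > 0" and H: "X_form B \<tau> H"
  shows "pos_def_hermitian H"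
  unfolding pos_def_hermitian_def
proof (intro conjI allI impI)
  note BD = inner_productD[OF B]
  show "hermitian_form H" using H by (simp add: X_form_def)
  fix x :: "complex ^ 'n" assume "x \<noteq> 0"
  have "H = X_hermitian B \<tau>"
    using X_form_unique[OF _ H X_form_X_hermitian[OF B]] \<tau> by simp
  then have "Re (H x x) = (B (Re_vec x) (Re_vec x) + B (Im_vec x) (Im_vec x)) / Im \<tau>"
    by (simp add: X_hermitian_def)
  moreover have "B v v \<ge> 0" for v
    using BD(3)[of v] bilinear_lzero[OF BD(1)] by (cases "v = 0") auto
  moreover have "Re_vec x \<noteq> 0 \<or> Im_vec x \<noteq> 0"
    using \<open>x \<noteq> 0\<close> cvec_Re_Im_vec[of x] by (auto simp: cvec_simps)
  ultimately show "Re (H x x) > 0"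
    using \<tau> BD(3)[of "Re_vec x"] BD(3)[of "Im_vec x"]
    by (auto intro!: divide_pos_pos intro: add_pos_nonneg add_nonneg_pos)
qed

lemma X_lattice_eq_image:
  "X_lattice L B \<tau> = (\<lambda>(u, v). cvec u + \<tau> *s cvec v) ` (L \<times> dual_lattice B L)"
  by (auto simp: X_lattice_def)

lemma X_lattice_iff:
  assumes "Im \<tau> \<noteq> 0"
  shows "cvec u + \<tau> *s cvec v \<in> X_lattice L B \<tau> \<longleftrightarrow> u \<in> L \<and> v \<in> dual_lattice B L"
  by (auto simp: X_lattice_def tau_coordinates_inject[OF assms])

lemma full_lattice_X_lattice:
  assumes "inner_product B" "full_lattice L" "Im \<tau> \<noteq> 0"
  shows "full_lattice (X_lattice L B \<tau>)"
  unfolding X_lattice_eq_image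
  by (intro full_lattice_linear_image tau_coordinates full_lattice_Times full_lattice_dual assms)

text \<open>With \<open>M\<close> the dual lattice of \<open>L\<close>, the imaginary part of the form sends \<open>(l + \<tau> m, l' + \<tau> m')\<close> to
  \<open>B(l, m') - B(l', m)\<close>.  So \<open>l + \<tau> m\<close> represents \<open>f\<close> iff \<open>f l' = - B(l', m)\<close> for all \<open>l'\<close> in \<open>L\<close> and
  \<open>f(\<tau> m') = B(l, m')\<close> for all \<open>m'\<close> in \<open>M\<close>.  As \<open>f\<close> is integer valued, the first condition puts \<open>m\<close> into \<open>M\<close>,
  and the second puts \<open>l\<close> into the dual of \<open>M\<close>, which is \<open>L\<close>.\<close>

lemma X_form_unimodular:
  fixes L :: "(real ^ 'n) set"
  assumes B: "inner_product B" and L: "full_lattice L" and \<tau>: "Im \<tau> \<noteq> 0" and H: "X_form B \<tau> H"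
  shows "unimodular_on (\<lambda>x y. Im (H x y)) (X_lattice L B \<tau>)"
  unfolding unimodular_on_def
proof (intro allI impI, elim conjE)
  let ?\<Lambda> = "X_lattice L B \<tau>" and ?M = "dual_lattice B L"
  note BD = inner_productD[OF B]
  fix f :: "complex ^ 'n \<Rightarrow> real" assume add: "additive_on ?\<Lambda> f" and int: "\<forall>x\<in>?\<Lambda>. f x \<in> \<int>"
  note M = full_lattice_dual[OF B L]
  note L0 = add_subgroupD(1)[OF full_lattice_add_subgroup[OF L]]
    and M0 = add_subgroupD(1)[OF full_lattice_add_subgroup[OF M]]
  have mem1: "cvec l \<in> ?\<Lambda>" if "l \<in> L" for l
    using X_lattice_iff[OF \<tau>, of l 0] that M0 by (simp add: cvec_simps)
  have mem2: "\<tau> *s cvec m \<in> ?\<Lambda>" if "m \<in> ?M" for m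
    using X_lattice_iff[OF \<tau>, of 0 m] that L0 by (simp add: cvec_simps)
  have f_add: "f (x + y) = f x + f y" if "x \<in> ?\<Lambda>" "y \<in> ?\<Lambda>" for x y
    using add that by (simp add: additive_on_def)
  have "additive_on L (\<lambda>l. f (cvec l))"
    unfolding additive_on_def by (auto simp: cvec_simps intro!: f_add mem1)
  then obtain A1 where A1: "linear A1" "\<And>l. l \<in> L \<Longrightarrow> A1 l = f (cvec l)"
    using additive_on_linear_extension[OF L] by metis
  have "additive_on ?M (\<lambda>m. f (\<tau> *s cvec m))"
    unfolding additive_on_def
    by (auto simp: cvec_simps vec.scale_right_distrib intro!: f_add mem2)
  then obtain A2 where A2: "linear A2" "\<And>m. m \<in> ?M \<Longrightarrow> A2 m = f (\<tau> *s cvec m)"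
    using additive_on_linear_extension[OF M] by metis
  obtain m where m: "\<And>u. B m u = - A1 u"
    using inner_product_represents_functional[OF B linear_compose_neg[OF A1(1)]] by blast
  obtain l where l: "\<And>u. B l u = A2 u"
    using inner_product_represents_functional[OF B A2(1)] by blast
  have mM: "m \<in> ?M"
    using int mem1 A1(2) by (auto simp: dual_lattice_def m)
  have "l \<in> dual_lattice B ?M"
    using int mem2 A2(2) by (auto simp: dual_lattice_def[of B ?M] l)
  then have lL: "l \<in> L" by (simp add: dual_dual_lattice[OF B L])
  show "\<exists>!x. x \<in> ?\<Lambda> \<and> (\<forall>y\<in>?\<Lambda>. Im (H x y) = f y)"
  proof (rule ex1I[of _ "cvec l + \<tau> *s cvec m"], intro conjI ballI)
    show "cvec l + \<tau> *s cvec m \<in> ?\<Lambda>" using X_lattice_iff[OF \<tau>] lL mM by blast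
    fix y assume "y \<in> ?\<Lambda>"
    then obtain l' m' where y: "y = cvec l' + \<tau> *s cvec m'" "l' \<in> L" "m' \<in> ?M"
      by (auto simp: X_lattice_def)
    have "Im (H (cvec l + \<tau> *s cvec m) y) = A2 m' + A1 l'"
      unfolding y(1) X_form_Im[OF H] using BD(2)[of l' m] by (simp add: l m)
    also have "\<dots> = f y"
      unfolding y(1) using y(2,3) by (simp add: A1(2) A2(2) f_add mem1 mem2)
    finally show "Im (H (cvec l + \<tau> *s cvec m) y) = f y" .
  next
    fix x assume "x \<in> ?\<Lambda> \<and> (\<forall>y\<in>?\<Lambda>. Im (H x y) = f y)"
    then obtain a b where x: "x = cvec a + \<tau> *s cvec b" and eq: "\<And>y. y \<in> ?\<Lambda> \<Longrightarrow> Im (H x y) = f y"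
      by (auto simp: X_lattice_def)
    have "b = m"
    proof (rule inner_product_eqI[OF B full_lattice_span[OF L]])
      fix k assume k: "k \<in> L"
      have "- B k b = A1 k"
        using eq[OF mem1[OF k]] X_form_Im[OF H, of a b k 0] A1(2)[OF k]
        by (simp add: x cvec_simps bilinear_rzero[OF BD(1)])
      then show "B b k = B m k" using BD(2)[of k b] by (simp add: m)
    qed
    moreover have "a = l"
    proof (rule inner_product_eqI[OF B full_lattice_span[OF M]])
      fix k assume k: "k \<in> ?M"
      show "B a k = B l k"
        using eq[OF mem2[OF k]] X_form_Im[OF H, of a b 0 k] A2(2)[OF k]
        by (simp add: x l cvec_simps bilinear_lzero[OF BD(1)])
    qed
    ultimately show "x = cvec l + \<tau> *s cvec m" by (simp add: x)
  qed
qed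

lemma ppav_X_lattice:
  assumes B: "inner_product B" and L: "full_lattice L" and \<tau>: "Im \<tau> > 0" and H: "X_form B \<tau> H"
  shows "ppav (X_lattice L B \<tau>) H"
  unfolding ppav_def
proof (intro conjI)
  have \<tau>0: "Im \<tau> \<noteq> 0" using \<tau> by simp
  show "full_lattice (X_lattice L B \<tau>)" by (rule full_lattice_X_lattice[OF B L \<tau>0])
  show "pos_def_hermitian H" by (rule X_form_pos_def[OF B \<tau> H])
  show "unimodular_on (\<lambda>x y. Im (H x y)) (X_lattice L B \<tau>)" by (rule X_form_unimodular[OF B L \<tau>0 H])
  show "integral_on (\<lambda>x y. Im (H x y)) (X_lattice L B \<tau>)"
    unfolding integral_on_def
  proof (intro ballI)
    fix x y assume "x \<in> X_lattice L B \<tau>" "y \<in> X_lattice L B \<tau>"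
    then obtain l m l' m' where xy: "x = cvec l + \<tau> *s cvec m" "y = cvec l' + \<tau> *s cvec m'"
      "l \<in> L" "m \<in> dual_lattice B L" "l' \<in> L" "m' \<in> dual_lattice B L"
      by (auto simp: X_lattice_def)
    have "Im (H x y) = B m' l - B m l'"
      using inner_productD(2)[OF B, of l m'] inner_productD(2)[OF B, of l' m]
      by (simp add: xy(1,2) X_form_Im[OF H])
    then show "Im (H x y) \<in> \<int>" using xy(3-6) by (simp add: dual_lattice_def)
  qed
qed

section \<open>The group action\<close>

lemma isometry_bij:
  fixes R :: "'a::euclidean_space \<Rightarrow> 'a"
  assumes B: "inner_product B" and R: "linear R" "\<And>u v. B (R u) (R v) = B u v"
  shows "bij R"
proof -
  note BD = inner_productD[OF B]
  have "u = 0" if "R u = 0" for u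
    using R(2)[of u u] BD(3)[of u] bilinear_lzero[OF BD(1)] that by force
  then have "inj R" using linear_injective_0[OF R(1)] by blast
  then show ?thesis using linear_injective_imp_surjective[OF R(1)] by (simp add: bij_def)
qed

lemma isometry_dual_lattice:
  fixes R :: "'a::euclidean_space \<Rightarrow> 'a"
  assumes B: "inner_product B" and R: "linear R" "\<And>u v. B (R u) (R v) = B u v" "R ` L = L"
  shows "R ` dual_lattice B L = dual_lattice B L"
proof -
  have *: "R u \<in> dual_lattice B L \<longleftrightarrow> u \<in> dual_lattice B L" for u
  proof -
    have "R u \<in> dual_lattice B L \<longleftrightarrow> (\<forall>l\<in>R ` L. B (R u) l \<in> \<int>)"
      using R(3) by (simp add: dual_lattice_def)
    also have "\<dots> \<longleftrightarrow> u \<in> dual_lattice B L" by (simp add: dual_lattice_def R(2))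
    finally show ?thesis .
  qed
  show ?thesis
  proof
    show "R ` dual_lattice B L \<subseteq> dual_lattice B L" using * by blast
    show "dual_lattice B L \<subseteq> R ` dual_lattice B L"
    proof
      fix m assume m: "m \<in> dual_lattice B L"
      obtain u where "m = R u" using bij_is_surj[OF isometry_bij[OF B R(1,2)]] by (metis surjD)
      with m * show "m \<in> R ` dual_lattice B L" by blast
    qed
  qed
qed

lemma complexify_image_X_lattice:
  assumes R: "linear R" "R ` L = L" "R ` dual_lattice B L = dual_lattice B L"
  shows "complexify R ` X_lattice L B \<tau> = X_lattice L B \<tau>"
proof -
  have "complexify R ` X_lattice L B \<tau> =
      (\<lambda>(u, v). cvec u + \<tau> *s cvec v) ` (R ` L \<times> R ` dual_lattice B L)"
    unfolding X_lattice_eq_image image_image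
    by (force simp: complexify_tau[OF R(1)] image_iff)
  then show ?thesis by (simp add: R X_lattice_eq_image)
qed

text \<open>The pullback of \<open>H\<close> has the same imaginary part as \<open>H\<close>, hence equals \<open>H\<close> by uniqueness.\<close>

lemma X_form_complexify_isometry:
  assumes H: "X_form B \<tau> H" and \<tau>: "Im \<tau> \<noteq> 0"
    and R: "linear R" "\<And>u v. B (R u) (R v) = B u v"
  shows "H (complexify R v) (complexify R w) = H v w"
proof -
  note A = clinearD[OF clinear_complexify[OF R(1)]]
  have "X_form B \<tau> (\<lambda>v w. H (complexify R v) (complexify R w))"
    unfolding X_form_def
  proof (intro conjI allI)
    show "hermitian_form (\<lambda>v w. H (complexify R v) (complexify R w))"
      using H unfolding X_form_def hermitian_form_def A(1,2) by blast
    show "Im (H (complexify R (cvec u + \<tau> *s cvec u')) (complexify R (cvec v + \<tau> *s cvec v')))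
        = B u v' - B v u'" for u u' v v'
      unfolding complexify_tau[OF R(1)] X_form_Im[OF H] R(2) ..
  qed
  from fun_cong[OF fun_cong[OF X_form_unique[OF \<tau> this H], of v], of w] show ?thesis .
qed

lemma faithful_integral_repD:
  assumes "faithful_integral_rep G L \<rho>"
  shows "full_lattice L" "g \<in> carrier G \<Longrightarrow> additive_on L (\<rho> g)" "inj_on \<rho> (carrier G)"
    "g \<in> carrier G \<Longrightarrow> \<rho> g ` L = L" "g \<in> carrier G \<Longrightarrow> \<rho> g \<in> extensional L"
    "g \<in> carrier G \<Longrightarrow> h \<in> carrier G \<Longrightarrow> l \<in> L \<Longrightarrow> \<rho> (g \<otimes>\<^bsub>G\<^esub> h) l = \<rho> g (\<rho> h l)"
proof -
  have "faithful_action G L \<rho>" using assms by (simp add: faithful_integral_rep_def)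
  then have hom: "\<rho> \<in> hom G (BijGroup L)" and inj: "inj_on \<rho> (carrier G)"
    by (auto simp: faithful_action_def faithful_action_axioms_def group_action_def group_hom_def
        group_hom_axioms_def)
  show "full_lattice L" "g \<in> carrier G \<Longrightarrow> additive_on L (\<rho> g)" "inj_on \<rho> (carrier G)"
    using assms inj by (auto simp: faithful_integral_rep_def)
  have Bij: "\<rho> g \<in> Bij L" if "g \<in> carrier G" for g
    using hom that by (auto simp: hom_def BijGroup_def)
  then show "g \<in> carrier G \<Longrightarrow> \<rho> g ` L = L" "g \<in> carrier G \<Longrightarrow> \<rho> g \<in> extensional L"
    by (auto simp: Bij_def bij_betw_def)
  assume gh: "g \<in> carrier G" "h \<in> carrier G" and l: "l \<in> L"
  have "\<rho> (g \<otimes>\<^bsub>G\<^esub> h) = compose L (\<rho> g) (\<rho> h)"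
    using hom gh Bij by (auto simp: hom_def BijGroup_def)
  then show "\<rho> (g \<otimes>\<^bsub>G\<^esub> h) l = \<rho> g (\<rho> h l)" using l by (simp add: compose_def)
qed

lemma real_extension_of_representation:
  assumes \<rho>: "faithful_integral_rep G L \<rho>" and g: "g \<in> carrier G"
  shows "linear (real_extension L (\<rho> g))" "l \<in> L \<Longrightarrow> real_extension L (\<rho> g) l = \<rho> g l"
proof -
  note L = faithful_integral_repD(1)[OF \<rho>]
  obtain A where A: "linear A \<and> (\<forall>l\<in>L. A l = \<rho> g l)"
    using additive_on_linear_extension[OF L faithful_integral_repD(2)[OF \<rho> g]] by metis
  then have "real_extension L (\<rho> g) = A" by (intro real_extension_eq[OF L]) auto
  then show "linear (real_extension L (\<rho> g))" "l \<in> L \<Longrightarrow> real_extension L (\<rho> g) l = \<rho> g l"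
    using A by auto
qed

text \<open>The action on the torus is induced by the complexified isometry, from which its analytic representation,
  its homomorphism property and its effect on \<open>H\<close> can be read off.\<close>

lemma X_action_properties:
  fixes G :: "('g, 'k) monoid_scheme" and L :: "(real ^ 'n) set"
  assumes B: "inner_product B" and \<tau>: "Im \<tau> \<noteq> 0"
    and \<rho>: "faithful_integral_rep G L \<rho>" and inv: "invariant_form G L \<rho> B"
    and g: "g \<in> carrier G"
  defines "\<Lambda> \<equiv> X_lattice L B \<tau>" and "R \<equiv> real_extension L (\<rho> g)"
  shows "complex_extension L (\<rho> g) = complexify R"
    "complexify R ` \<Lambda> = \<Lambda>"
    "X_action L \<rho> \<Lambda> g (v +o \<Lambda>) = complexify R v +o \<Lambda>"
    "analytic_rep \<Lambda> (X_action L \<rho> \<Lambda> g) = complexify R"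
    "torus_iso \<Lambda> \<Lambda> (X_action L \<rho> \<Lambda> g)"
proof -
  have R: "linear R" "\<And>l. l \<in> L \<Longrightarrow> R l = \<rho> g l" "\<And>u v. B (R u) (R v) = B u v"
    using inv g unfolding R_def invariant_form_def
    by (blast intro: real_extension_of_representation[OF \<rho> g])+
  note L = faithful_integral_repD(1)[OF \<rho>]
  note \<Lambda> = full_lattice_X_lattice[OF B L \<tau>, folded \<Lambda>_def]
  note sub = full_lattice_add_subgroup[OF \<Lambda>]
  note A = clinear_complexify[OF R(1)]
  show ext: "complex_extension L (\<rho> g) = complexify R"
    using R g by (intro complex_extension_eq[OF L]) auto
  have RL: "R ` L = L"
    using faithful_integral_repD(4)[OF \<rho> g] R(2) by (metis image_cong)
  have RM: "R ` dual_lattice B L = dual_lattice B L"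
    by (rule isometry_dual_lattice[OF B R(1) R(3) RL])
  show im: "complexify R ` \<Lambda> = \<Lambda>"
    unfolding \<Lambda>_def by (rule complexify_image_X_lattice[OF R(1) RL RM])
  show act: "X_action L \<rho> \<Lambda> g (v +o \<Lambda>) = complexify R v +o \<Lambda>" for v
  proof -
    have "v +o \<Lambda> \<in> torus \<Lambda>" by (simp add: torus_def)
    then show ?thesis
      by (simp add: X_action_def ext clinear_image_coset[OF A] im)
  qed
  show "analytic_rep \<Lambda> (X_action L \<rho> \<Lambda> g) = complexify R"
    by (rule analytic_rep_induced[OF \<Lambda> A act])
  show "torus_iso \<Lambda> \<Lambda> (X_action L \<rho> \<Lambda> g)"
    by (rule torus_iso_induced[OF sub sub A complexify_bij[OF isometry_bij[OF B R(1) R(3)]] im act])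
qed

lemma ppav_action_X_action:
  assumes G: "group G" and B: "inner_product B" and \<tau>: "Im \<tau> \<noteq> 0" and H: "X_form B \<tau> H"
    and \<rho>: "faithful_integral_rep G L \<rho>" and inv: "invariant_form G L \<rho> B"
  shows "ppav_action G (X_lattice L B \<tau>) H (X_action L \<rho> (X_lattice L B \<tau>))"
proof -
  let ?\<Lambda> = "X_lattice L B \<tau>"
  let ?\<phi> = "X_action L \<rho> ?\<Lambda>"
  note L = faithful_integral_repD(1)[OF \<rho>]
  define R where "R g = real_extension L (\<rho> g)" for g
  have R: "linear (R g)" "\<And>l. l \<in> L \<Longrightarrow> R g l = \<rho> g l" "\<And>u v. B (R g u) (R g v) = B u v"
    if g: "g \<in> carrier G" for g
    using inv g unfolding R_def invariant_form_def
    by (blast intro: real_extension_of_representation[OF \<rho> g])+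
  note X = X_action_properties[OF B \<tau> \<rho> inv, folded R_def]
  have Bij: "?\<phi> g \<in> Bij (torus ?\<Lambda>)" if "g \<in> carrier G" for g
    using X(5)[OF that] by (simp add: Bij_def torus_iso_def X_action_def)
  have mult: "?\<phi> (g \<otimes>\<^bsub>G\<^esub> h) = compose (torus ?\<Lambda>) (?\<phi> g) (?\<phi> h)"
    if g: "g \<in> carrier G" and h: "h \<in> carrier G" for g h
  proof -
    have gh: "g \<otimes>\<^bsub>G\<^esub> h \<in> carrier G" using G g h by (simp add: group.is_monoid monoid.m_closed)
    have "complex_extension L (\<rho> (g \<otimes>\<^bsub>G\<^esub> h)) = complexify (R g \<circ> R h)"
    proof (rule complex_extension_eq[OF L linear_compose[OF R(1)[OF h] R(1)[OF g]]])
      fix l assume l: "l \<in> L"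
      have "\<rho> h l \<in> L" using faithful_integral_repD(4)[OF \<rho> h] l by blast
      then show "(R g \<circ> R h) l = \<rho> (g \<otimes>\<^bsub>G\<^esub> h) l"
        using R(2) g h l by (simp add: faithful_integral_repD(6)[OF \<rho> g h l])
    qed
    then have c: "complexify (R (g \<otimes>\<^bsub>G\<^esub> h)) = complexify (R g) \<circ> complexify (R h)"
      using X(1)[OF gh] by (simp add: complexify_o)
    show ?thesis
    proof (rule extensionalityI[of _ "torus ?\<Lambda>"])
      show "?\<phi> (g \<otimes>\<^bsub>G\<^esub> h) \<in> extensional (torus ?\<Lambda>)" by (simp add: X_action_def)
      show "compose (torus ?\<Lambda>) (?\<phi> g) (?\<phi> h) \<in> extensional (torus ?\<Lambda>)" by (rule compose_extensional)
      fix P assume P: "P \<in> torus ?\<Lambda>"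
      then obtain v where v: "P = v +o ?\<Lambda>" by (auto simp: torus_def)
      show "?\<phi> (g \<otimes>\<^bsub>G\<^esub> h) P = compose (torus ?\<Lambda>) (?\<phi> g) (?\<phi> h) P"
        using P by (simp add: compose_def v X(3)[OF gh] X(3)[OF g] X(3)[OF h] c)
    qed
  qed
  have inj: "inj_on ?\<phi> (carrier G)"
  proof (rule inj_onI)
    fix g h assume g: "g \<in> carrier G" and h: "h \<in> carrier G" and eq: "?\<phi> g = ?\<phi> h"
    have "complexify (R g) = complexify (R h)"
      using X(4)[OF g] X(4)[OF h] eq by simp
    then have "R g u = R h u" for u
      using complexify_cvec[OF R(1)[OF g], of u] complexify_cvec[OF R(1)[OF h], of u]
      by (simp add: cvec_inject)
    then have "\<rho> g l = \<rho> h l" if "l \<in> L" for l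
      using R(2)[OF g that] R(2)[OF h that] by simp
    then have "\<rho> g = \<rho> h"
      using extensionalityI[OF faithful_integral_repD(5)[OF \<rho> g] faithful_integral_repD(5)[OF \<rho> h]] by blast
    then show "g = h" using faithful_integral_repD(3)[OF \<rho>] g h by (simp add: inj_on_def)
  qed
  have "?\<phi> \<in> hom G (BijGroup (torus ?\<Lambda>))"
    using Bij mult by (auto simp: hom_def BijGroup_def)
  then have "faithful_action G (torus ?\<Lambda>) ?\<phi>"
    using G inj group_BijGroup
    by (auto simp: faithful_action_def faithful_action_axioms_def group_action_def group_hom_def
        group_hom_axioms_def)
  moreover have "?\<phi> g \<in> aut_preserving ?\<Lambda> H" if g: "g \<in> carrier G" for g
    using Bij[OF g] X(4,5)[OF g] X_form_complexify_isometry[OF H \<tau> R(1)[OF g] R(3)[OF g]]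
    by (simp add: aut_preserving_def)
  ultimately show ?thesis by (simp add: ppav_action_def)
qed

lemma X_rho_decomposition:
  assumes B: "inner_product B" and \<tau>: "Im \<tau> \<noteq> 0" and H: "X_form B \<tau> H"
    and \<rho>: "faithful_integral_rep G L \<rho>" and inv: "invariant_form G L \<rho> B"
  shows "rho_decomposition G L \<rho> (X_lattice L B \<tau>) H (X_action L \<rho> (X_lattice L B \<tau>))
    (cvec ` L) ((\<lambda>m. \<tau> *s cvec m) ` dual_lattice B L)"
proof -
  let ?\<Lambda> = "X_lattice L B \<tau>" and ?M = "dual_lattice B L"
  let ?\<phi> = "X_action L \<rho> ?\<Lambda>" and ?L1 = "cvec ` L" and ?L2 = "(\<lambda>m. \<tau> *s cvec m) ` dual_lattice B L"
  note BD = inner_productD[OF B]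
  note L = faithful_integral_repD(1)[OF \<rho>]
  note LD = add_subgroupD[OF full_lattice_add_subgroup[OF L]]
  note MD = add_subgroupD[OF add_subgroup_dual_lattice[OF B, of L]]
  define R where "R g = real_extension L (\<rho> g)" for g
  have R: "linear (R g)" "\<And>l. l \<in> L \<Longrightarrow> R g l = \<rho> g l" "\<And>u v. B (R g u) (R g v) = B u v"
    if g: "g \<in> carrier G" for g
    using inv g unfolding R_def invariant_form_def
    by (blast intro: real_extension_of_representation[OF \<rho> g])+
  note X = X_action_properties[OF B \<tau> \<rho> inv, folded R_def]
  have "add_subgroup ?L1"
    using LD(1,2) by (force simp: add_subgroup_def simp flip: cvec_simps(2) cvec_simps(3))
  moreover have "add_subgroup ?L2"
    unfolding add_subgroup_def
  proof (intro conjI ballI)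
    show "0 \<in> ?L2" using MD(1) by (force simp: cvec_simps)
    fix x y assume "x \<in> ?L2" "y \<in> ?L2"
    then obtain a b where ab: "x = \<tau> *s cvec a" "y = \<tau> *s cvec b" "a \<in> ?M" "b \<in> ?M" by blast
    have "x - y = \<tau> *s cvec (a - b)" by (simp add: ab(1,2) cvec_simps vec.scale_right_diff_distrib)
    with MD(2)[OF ab(3,4)] show "x - y \<in> ?L2" by blast
  qed
  moreover have "?L1 + ?L2 = ?\<Lambda>"
    by (auto simp: set_plus_def X_lattice_def)
  moreover have "?L1 \<inter> ?L2 = {0}"
  proof
    show "?L1 \<inter> ?L2 \<subseteq> {0}"
    proof
      fix x assume "x \<in> ?L1 \<inter> ?L2"
      then obtain l m where x: "x = cvec l" "x = \<tau> *s cvec m" by blast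
      then have "cvec l + \<tau> *s cvec 0 = cvec 0 + \<tau> *s cvec m" by (simp add: cvec_simps)
      then have "l = 0" unfolding tau_coordinates_inject[OF \<tau>] by blast
      then show "x \<in> {0}" by (simp add: x(1) cvec_simps)
    qed
    show "{0} \<subseteq> ?L1 \<inter> ?L2" using LD(1) MD(1) by (force simp: cvec_simps)
  qed
  moreover have "\<forall>x\<in>?L1. \<forall>y\<in>?L1. Im (H x y) = 0"
    using X_form_Im[OF H, of _ 0 _ 0] by (simp add: cvec_simps bilinear_rzero[OF BD(1)])
  moreover have "\<forall>x\<in>?L2. \<forall>y\<in>?L2. Im (H x y) = 0"
    using X_form_Im[OF H, of 0 _ 0 _] by (simp add: cvec_simps bilinear_lzero[OF BD(1)])
  ultimately have dec: "decomposition ?\<Lambda> H ?L1 ?L2" by (simp add: decomposition_def)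
  have on1: "complexify (R g) (cvec l) = cvec (\<rho> g l)" if "g \<in> carrier G" "l \<in> L" for g l
    using that R(2) by (simp add: complexify_cvec[OF R(1)])
  have inv1: "complexify (R g) ` ?L1 \<subseteq> ?L1" if "g \<in> carrier G" for g
    using faithful_integral_repD(4)[OF \<rho> that] on1[OF that] by auto
  have inv2: "complexify (R g) ` ?L2 \<subseteq> ?L2" if g: "g \<in> carrier G" for g
  proof -
    have RL: "R g ` L = L" using faithful_integral_repD(4)[OF \<rho> g] R(2)[OF g] by (metis image_cong)
    have "R g ` ?M = ?M" by (rule isometry_dual_lattice[OF B R(1)[OF g] R(3)[OF g] RL])
    moreover have "complexify (R g) (\<tau> *s cvec m) = \<tau> *s cvec (R g m)" for m
      by (simp add: clinearD[OF clinear_complexify[OF R(1)[OF g]]] complexify_cvec[OF R(1)[OF g]])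
    ultimately show ?thesis by auto
  qed
  have "bij_betw cvec L ?L1" by (simp add: bij_betw_def inj_on_def cvec_inject)
  moreover have "additive_on L cvec" by (simp add: additive_on_def cvec_simps)
  moreover have "cvec (\<rho> g l) = analytic_rep ?\<Lambda> (?\<phi> g) (cvec l)" if "g \<in> carrier G" "l \<in> L" for g l
    using that by (simp add: X(4) on1)
  ultimately show ?thesis
    unfolding rho_decomposition_def using dec inv1 inv2 X(4) by auto
qed

section \<open>Splitting into elliptic curves\<close>

lemma int_span_pair:
  assumes "a \<noteq> b"
  shows "int_span {a, b} = {of_int k *\<^sub>R a + of_int m *\<^sub>R b | k m. True}"
proof -
  have "int_span {b} = {of_int m *\<^sub>R b | m. True}"
    using int_span_insert[of "{}" b] by (simp add: int_span_def[of "{}"])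
  then show ?thesis using int_span_insert[of "{b}" a] assms by auto
qed

lemma full_lattice_complex_pair:
  fixes r :: real
  assumes "r \<noteq> 0" "Im \<tau> \<noteq> 0"
  shows "full_lattice (int_span {of_real r, \<tau>})"
proof (rule full_lattice_int_span)
  have "z \<in> span {of_real r, \<tau>}" for z
  proof -
    have "z = ((Re z - Im z / Im \<tau> * Re \<tau>) / r) *\<^sub>R of_real r + (Im z / Im \<tau>) *\<^sub>R \<tau>"
      using assms by (simp add: complex_eq_iff)
    also have "\<dots> \<in> span {of_real r, \<tau>}"
      by (intro span_add span_scale span_base) auto
    finally show ?thesis .
  qed
  then show "span {of_real r, \<tau>} = UNIV" by auto
  show "card {of_real r, \<tau>} \<le> DIM(complex)" by (simp add: card_insert_if)
qed simp

text \<open>A stacked basis of \<open>L\<close> in its dual lattice, taken as a complex basis of \<open>V\<close>, gives coordinates in which \<open>L\<close> becomes a product of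
  lattices \<open>\<int> d\<close> and the dual lattice becomes \<open>\<int>\<^sup>n\<close>, so that their combination with \<open>\<tau>\<close> is a product too.\<close>

lemma X_iso_product_of_elliptic_curves:
  fixes L :: "(real ^ 'n) set"
  assumes B: "inner_product B" and L: "full_lattice L" and int: "integral_on B L" and \<tau>: "Im \<tau> \<noteq> 0"
  shows "iso_product_of_elliptic_curves (X_lattice L B \<tau>)"
proof -
  let ?M = "dual_lattice B L" and ?\<Lambda> = "X_lattice L B \<tau>"
  obtain T where T: "finite T" "independent T" "span T = UNIV" "?M = int_span T"
    using full_lattice_dual[OF B L] by (auto simp: full_lattice_def)
  have "L \<subseteq> int_span T"
    using int unfolding T(4)[symmetric] by (auto simp: integral_on_def dual_lattice_def)
  then obtain S d where S: "finite S" "independent S" "card S = card T" "int_span S = int_span T"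
    and LS: "L = {\<Sum>b\<in>S. of_int (c b * d b) *\<^sub>R b | c :: real ^ 'n \<Rightarrow> int. True}"
    using stacked_basis[OF T(1,2) full_lattice_add_subgroup[OF L]] by blast
  \<comment> \<open>\<open>L\<close> has full rank, so no elementary divisor vanishes.\<close>
  have d: "d b \<noteq> 0" if b: "b \<in> S" for b
  proof
    assume "d b = 0"
    have "(\<Sum>s\<in>S. of_int (c s * d s) *\<^sub>R s) \<in> span (S - {b})" for c
      by (intro span_sum) (metis DiffI \<open>d b = 0\<close> mult_zero_right of_int_0 scaleR_zero_left singletonD span_base span_scale span_zero)
    then have "L \<subseteq> span (S - {b})" unfolding LS by blast
    then have "span L \<subseteq> span (S - {b})" by (rule span_minimal) (rule subspace_span)
    then have "b \<in> span (S - {b})" using full_lattice_span[OF L] by auto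
    then show False using S(2) b by (auto simp: dependent_def)
  qed
  have spanS: "span S = UNIV" using span_int_span[OF S(1)] span_int_span[OF T(1)] S(4) T(3) by simp
  have "card S = CARD('n)" using basis_card_eq_dim[of S UNIV] S(2) spanS by (simp add: dim_UNIV)
  then obtain e :: "'n \<Rightarrow> real ^ 'n" where e: "bij_betw e UNIV S"
    using finite_same_card_bij[of "UNIV :: 'n set" S] S(1) by auto
  have eS: "e i \<in> S" for i using e by (auto simp: bij_betw_def)
  define A where "A x = (\<Sum>i\<in>UNIV. (x $ i) *\<^sub>R e i)" for x :: "real ^ 'n"
  have A: "linear A"
    unfolding A_def by (rule linearI) (simp_all add: scaleR_add_left sum.distrib scaleR_sum_right)
  have A_sum: "A (\<chi> i. g (e i)) = (\<Sum>b\<in>S. g b *\<^sub>R b)" for g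
    unfolding A_def using sum.reindex_bij_betw[OF e, of "\<lambda>b. g b *\<^sub>R b"] by simp
  have "surj A"
  proof -
    have "x \<in> range A" for x
    proof -
      have "x = A (\<chi> i. representation S x (e i))"
        unfolding A_sum using S spanS by (simp add: sum_representation_eq)
      then show ?thesis by blast
    qed
    then show ?thesis by auto
  qed
  then have "bij A" using linear_surjective_imp_injective[OF A] by (simp add: bij_def)
  have L_image: "L = A ` {u. \<forall>i. \<exists>k::int. u $ i = of_int (k * d (e i))}"
  proof (intro subset_antisym subsetI)
    fix l assume "l \<in> L"
    then obtain c where "l = (\<Sum>b\<in>S. of_int (c b * d b) *\<^sub>R b)" unfolding LS by blast
    then have "l = A (\<chi> i. of_int (c (e i) * d (e i)))" using A_sum[of "\<lambda>b. of_int (c b * d b)"] by simp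
    then show "l \<in> A ` {u. \<forall>i. \<exists>k::int. u $ i = of_int (k * d (e i))}"
      by (rule image_eqI) auto
  next
    fix l assume "l \<in> A ` {u. \<forall>i. \<exists>k::int. u $ i = of_int (k * d (e i))}"
    then obtain u k where u: "l = A u" "\<And>i. u $ i = of_int (k i * d (e i))" by (auto, metis)
    have "u = (\<chi> i. of_int (k (inv_into UNIV e (e i)) * d (e i)))"
      using e by (simp add: vec_eq_iff u(2) bij_betw_def)
    then have "l = (\<Sum>b\<in>S. of_int (k (inv_into UNIV e b) * d b) *\<^sub>R b)"
      using A_sum[of "\<lambda>b. of_int (k (inv_into UNIV e b) * d b)"] u(1) by simp
    then show "l \<in> L" unfolding LS by (auto intro!: exI[of _ "\<lambda>b. k (inv_into UNIV e b)"])
  qed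
  have M_image: "?M = A ` {u. \<forall>i. u $ i \<in> \<int>}"
  proof (intro subset_antisym subsetI)
    fix l assume "l \<in> ?M"
    then obtain c where "l = (\<Sum>b\<in>S. of_int (c b) *\<^sub>R b)" unfolding T(4) S(4)[symmetric] by (rule int_spanE)
    then have "l = A (\<chi> i. of_int (c (e i)))" using A_sum[of "\<lambda>b. of_int (c b)"] by simp
    then show "l \<in> A ` {u. \<forall>i. u $ i \<in> \<int>}"
      by (rule image_eqI) auto
  next
    fix l assume "l \<in> A ` {u. \<forall>i. u $ i \<in> \<int>}"
    then obtain u where u: "l = A u" "\<And>i. u $ i \<in> \<int>" by auto
    show "l \<in> ?M"
      unfolding T(4) S(4)[symmetric] u(1) A_def
      by (intro add_subgroup_sum[OF add_subgroup_int_span])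
         (auto intro: add_subgroup_scale_Ints[OF add_subgroup_int_span int_span_base[OF S(1) eS] u(2)])
  qed
  define E where "E i = int_span {complex_of_real (of_int (d (e i))), \<tau>}" for i
  have E_iff: "z \<in> E i \<longleftrightarrow> (\<exists>k m. z = of_int (k * d (e i)) + \<tau> * of_int m)" for z i
  proof -
    have "complex_of_real (of_int (d (e i))) \<noteq> \<tau>" using \<tau> by auto
    from int_span_pair[OF this] show ?thesis
      unfolding E_def by (simp add: scaleR_conv_of_real mult.commute)
  qed
  have E: "full_lattice (E i)" for i
    unfolding E_def by (rule full_lattice_complex_pair) (use d[OF eS] \<tau> in auto)
  have sub: "add_subgroup (product_lattice E)"
    using add_subgroupD(1,2)[OF full_lattice_add_subgroup[OF E]]
    by (simp add: add_subgroup_def product_lattice_def)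
  let ?P = "complexify A"
  have image: "?P ` product_lattice E = ?\<Lambda>"
  proof (intro subset_antisym subsetI)
    fix x assume "x \<in> ?P ` product_lattice E"
    then obtain z where z: "x = ?P z" "\<And>i. z $ i \<in> E i" by (auto simp: product_lattice_def)
    then obtain k m where km: "\<And>i. z $ i = of_int (k i * d (e i)) + \<tau> * of_int (m i)"
      unfolding E_iff by metis
    let ?u = "(\<chi> i. of_int (k i * d (e i))) :: real ^ 'n" and ?v = "(\<chi> i. of_int (m i)) :: real ^ 'n"
    have "z = cvec ?u + \<tau> *s cvec ?v" by (simp add: vec_eq_iff km cvec_def)
    then have "x = cvec (A ?u) + \<tau> *s cvec (A ?v)" by (simp add: z(1) complexify_tau[OF A])
    moreover have "A ?u \<in> L" unfolding L_image by (rule imageI) auto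
    moreover have "A ?v \<in> ?M" unfolding M_image by (rule imageI) auto
    ultimately show "x \<in> ?\<Lambda>" using X_lattice_iff[OF \<tau>] by blast
  next
    fix x assume "x \<in> ?\<Lambda>"
    then obtain l m where x: "x = cvec l + \<tau> *s cvec m" "l \<in> L" "m \<in> ?M" by (auto simp: X_lattice_def)
    from x(2) obtain u where u: "l = A u" "\<And>i. \<exists>k::int. u $ i = of_int (k * d (e i))"
      unfolding L_image by blast
    from x(3) obtain v where v: "m = A v" "\<And>i. v $ i \<in> \<int>" unfolding M_image by blast
    have "(cvec u + \<tau> *s cvec v) $ i \<in> E i" for i
    proof -
      obtain k n :: int where "u $ i = of_int (k * d (e i))" "v $ i = of_int n"
        using u(2)[of i] v(2)[of i] by (metis Ints_cases)
      then show ?thesis unfolding E_iff by (intro exI[of _ k] exI[of _ n]) (simp add: cvec_def)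
    qed
    then have "cvec u + \<tau> *s cvec v \<in> product_lattice E" by (simp add: product_lattice_def)
    moreover have "x = ?P (cvec u + \<tau> *s cvec v)" by (simp add: x(1) u(1) v(1) complexify_tau[OF A])
    ultimately show "x \<in> ?P ` product_lattice E" by blast
  qed
  let ?Q = "inv_into UNIV ?P"
  note P = clinear_complexify[OF A] complexify_bij[OF \<open>bij A\<close>]
  have Q: "?Q ` ?\<Lambda> = product_lattice E"
    unfolding image[symmetric] image_image using P(2) by (simp add: bij_is_inj)
  have "torus_iso ?\<Lambda> (product_lattice E) (\<lambda>C. ?Q ` C)"
  proof (rule torus_iso_induced[OF _ sub clinear_inv[OF P] bij_imp_bij_inv[OF P(2)] Q])
    show "add_subgroup ?\<Lambda>"
      by (rule full_lattice_add_subgroup[OF full_lattice_X_lattice[OF B L \<tau>]])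
    show "?Q ` (v +o ?\<Lambda>) = ?Q v +o product_lattice E" for v
      by (simp add: clinear_image_coset[OF clinear_inv[OF P]] Q)
  qed
  then show ?thesis unfolding iso_product_of_elliptic_curves_def using E by blast
qed

theorem proposition2p4:
  fixes G :: "('g, 'k) monoid_scheme"
    and L :: "(real ^ 'n) set"
    and \<rho> :: "'g \<Rightarrow> real ^ 'n \<Rightarrow> real ^ 'n"
    and B :: "real ^ 'n \<Rightarrow> real ^ 'n \<Rightarrow> real"
    and \<tau> :: complex
  assumes "group G" and "finite (carrier G)"
    and "faithful_integral_rep G L \<rho>"
    and "inner_product B" and "invariant_form G L \<rho> B" and "integral_on B L"
    and "Im \<tau> > 0"
  shows "(\<exists>!H. X_form B \<tau> H) \<and>
    (\<forall>H. X_form B \<tau> H \<longrightarrow>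
       ppav (X_lattice L B \<tau>) H \<and>
       rho_decomposable G L \<rho> (X_lattice L B \<tau>) H \<and>
       ppav_action G (X_lattice L B \<tau>) H (X_action L \<rho> (X_lattice L B \<tau>)) \<and>
       (\<exists>L\<^sub>1 L\<^sub>2. rho_decomposition G L \<rho> (X_lattice L B \<tau>) H
          (X_action L \<rho> (X_lattice L B \<tau>)) L\<^sub>1 L\<^sub>2)) \<and>
    iso_product_of_elliptic_curves (X_lattice L B \<tau>)"
proof (intro conjI allI impI)
  have \<tau>: "Im \<tau> \<noteq> 0" using assms(7) by simp
  note L = faithful_integral_repD(1)[OF assms(3)]
  show "\<exists>!H. X_form B \<tau> H"
    using X_form_X_hermitian[OF assms(4) \<tau>] X_form_unique[OF \<tau>] by blast
  show "iso_product_of_elliptic_curves (X_lattice L B \<tau>)"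
    by (rule X_iso_product_of_elliptic_curves[OF assms(4) L assms(6) \<tau>])
  fix H assume H: "X_form B \<tau> H"
  show ppav: "ppav (X_lattice L B \<tau>) H"
    by (rule ppav_X_lattice[OF assms(4) L assms(7) H])
  show act: "ppav_action G (X_lattice L B \<tau>) H (X_action L \<rho> (X_lattice L B \<tau>))"
    by (rule ppav_action_X_action[OF assms(1,4) \<tau> H assms(3,5)])
  show dec: "\<exists>L\<^sub>1 L\<^sub>2. rho_decomposition G L \<rho> (X_lattice L B \<tau>) H
      (X_action L \<rho> (X_lattice L B \<tau>)) L\<^sub>1 L\<^sub>2"
    using X_rho_decomposition[OF assms(4) \<tau> H assms(3,5)] by blast
  show "rho_decomposable G L \<rho> (X_lattice L B \<tau>) H"
    unfolding rho_decomposable_def using ppav act dec by blast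
qed

end
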